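(* Let $(\alpha,\theta)\in\big((0,\pi]\times(0,\pi/2]\big)\setminus\{(\pi,\pi/2)\}$ be such that $\alpha/\pi$ is rational. Let $n_\alpha$ be the smallest positive integer $n$ with $n\alpha\equiv 0 \pmod{2\pi}$, and let $z_k(\alpha,\theta)=\cos^2\theta+\sin^2\theta\cos(k\alpha)$. Then the following experimental equations characterize $\mathcal{R}_{\alpha,\theta}$, i.e. a one-qubit CPSO $\mathbf{G}$ satisfies all of them if and only if $\mathbf{G}\in\mathcal{R}_{\alpha,\theta}$: $$\mathrm{Pr}^0[\mathbf{G}^{n_\alpha}(|1\rangle\langle1|)]=0\quad\text{and}\quad \mathrm{Pr}^0[\mathbf{G}^k(|0\rangle\langle0|)]=\tfrac12+\tfrac12 z_k(\alpha,\theta)\ \text{ for } k\in\{1,2,\dots,n_\alpha\}.$$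
   Context: A one-qubit density matrix is a positive semidefinite Hermitian $2\times2$ matrix of trace $1$. A one-qubit superoperator is a linear map on $\mathbb{C}^{2\times2}$; a superoperator is a PSO if it sends density matrices to density matrices; $\mathbf{G}$ is a CPSO if $\mathbf{G}\otimes\mathbf{I}_M$ is a PSO for every positive integer $M$, where $\mathbf{I}_M$ is the identity on $\mathbb{C}^{M\times M}$. $\mathrm{Pr}^0[\rho]=\langle0|\rho|0\rangle$. $\mathbf{G}^k$ is the $k$-fold composition of $\mathbf{G}$. For a unitary $A$, $\mathbf{A}$ denotes the CPSO $\rho\mapsto A\rho A^\dagger$. For $\alpha\in[-\pi,\pi]$, $\theta\in[0,\pi/2]$, $\phi\in[0,2\pi)$, put $|\psi\rangle=\cos(\theta/2)|0\rangle+e^{i\phi}\sin(\theta/2)|1\rangle$ and $|\psi^\perp\rangle=\sin(\theta/2)|0\rangle-e^{i\phi}\cos(\theta/2)|1\rangle$; $R_{\alpha,\theta,\phi}$ is the unitary on $\mathbb{C}^2$ with $R_{\alpha,\theta,\phi}|\psi\rangle=|\psi\rangle$ and $R_{\alpha,\theta,\phi}|\psi^\perp\rangle=e^{i\alpha}|\psi^\perp\rangle$. $\mathcal{R}_{\alpha,\theta}=\{\mathbf{R}_{\alpha,\theta,\phi},\mathbf{R}_{-\alpha,\theta,\phi}:\phi\in[0,2\pi)\}$. *)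

theory Defs
  imports
    "Jordan_Normal_Form.Schur_Decomposition"
    "HOL-Library.FuncSet"
    "HOL-Library.Real_Mod"
begin

definition density_matrix :: "nat \<Rightarrow> complex mat \<Rightarrow> bool" where
  "density_matrix n \<rho> \<longleftrightarrow>
     \<rho> \<in> carrier_mat n n \<and>
     mat_adjoint \<rho> = \<rho> \<and>
     (\<forall>v \<in> carrier_vec n. 0 \<le> Re ((\<rho> *\<^sub>v v) \<bullet>c v)) \<and>
     (\<Sum>i<n. \<rho> $$ (i, i)) = 1"

text \<open>
  Linear maps on the n by n matrices. They are required to be extensional, so that two of
  them are equal as HOL functions iff they agree on all n by n matrices.
\<close>

definition superoperator :: "nat \<Rightarrow> (complex mat \<Rightarrow> complex mat) \<Rightarrow> bool" where
  "superoperator n G \<longleftrightarrow>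
     G \<in> carrier_mat n n \<rightarrow>\<^sub>E carrier_mat n n \<and>
     (\<forall>X \<in> carrier_mat n n. \<forall>Y \<in> carrier_mat n n. G (X + Y) = G X + G Y) \<and>
     (\<forall>c. \<forall>X \<in> carrier_mat n n. G (c \<cdot>\<^sub>m X) = c \<cdot>\<^sub>m G X)"

definition pso :: "nat \<Rightarrow> (complex mat \<Rightarrow> complex mat) \<Rightarrow> bool" where
  "pso n G \<longleftrightarrow>
     superoperator n G \<and> (\<forall>\<rho>. density_matrix n \<rho> \<longrightarrow> density_matrix n (G \<rho>))"

text \<open>
  The index of a basis vector of the tensor product of an arbitrary space with an
  M-dimensional one is \<open>a * M + k\<close>, where \<open>a\<close> is the index in the first factor and
  \<open>k < M\<close> the index in the second. A 2M by 2M matrix \<open>X\<close> is then the sum over \<open>k, l < M\<close> of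
  the tensor products of \<open>tensor_block M X k l\<close> with the matrix unit \<open>E k l\<close>; \<open>tensor_id M G\<close>
  applies \<open>G\<close> to the first factor of each summand.
\<close>

definition tensor_block :: "nat \<Rightarrow> complex mat \<Rightarrow> nat \<Rightarrow> nat \<Rightarrow> complex mat" where
  "tensor_block M X k l = mat 2 2 (\<lambda>(a, b). X $$ (a * M + k, b * M + l))"

definition tensor_id ::
    "nat \<Rightarrow> (complex mat \<Rightarrow> complex mat) \<Rightarrow> (complex mat \<Rightarrow> complex mat)" where
  "tensor_id M G = (\<lambda>X \<in> carrier_mat (2 * M) (2 * M).
     mat (2 * M) (2 * M)
       (\<lambda>(i, j). G (tensor_block M X (i mod M) (j mod M)) $$ (i div M, j div M)))"

definition kronecker :: "complex mat \<Rightarrow> complex mat \<Rightarrow> complex mat" where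
  "kronecker A B = mat (dim_row A * dim_row B) (dim_col A * dim_col B)
     (\<lambda>(i, j). A $$ (i div dim_row B, j div dim_col B) * B $$ (i mod dim_row B, j mod dim_col B))"

lemma tensor_id_kronecker:
  assumes G: "superoperator 2 G" and A: "A \<in> carrier_mat 2 2" and B: "B \<in> carrier_mat M M"
  shows "tensor_id M G (kronecker A B) = kronecker (G A) B"
proof -
  have GA: "G A \<in> carrier_mat 2 2"
    using G A unfolding superoperator_def by (auto dest: PiE_mem)
  have block: "tensor_block M (kronecker A B) k l = B $$ (k, l) \<cdot>\<^sub>m A"
    if "k < M" "l < M" for k l
  proof (rule eq_matI)
    fix a b assume ab: "a < dim_row (B $$ (k, l) \<cdot>\<^sub>m A)" "b < dim_col (B $$ (k, l) \<cdot>\<^sub>m A)"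
    then have "a = 0 \<or> a = 1" "b = 0 \<or> b = 1" using A by auto
    then show "tensor_block M (kronecker A B) k l $$ (a, b) = (B $$ (k, l) \<cdot>\<^sub>m A) $$ (a, b)"
      using that A B ab by (auto simp: tensor_block_def kronecker_def)
  qed (use A in \<open>auto simp: tensor_block_def\<close>)
  show ?thesis
  proof (rule eq_matI)
    fix i j assume ij: "i < dim_row (kronecker (G A) B)" "j < dim_col (kronecker (G A) B)"
    then have b: "i < 2 * M" "j < 2 * M" using GA B by (auto simp: kronecker_def)
    then have M: "i mod M < M" "j mod M < M" by (cases M; auto)+
    have d: "i div M < 2" "j div M < 2" using b by (auto simp: less_mult_imp_div_less)
    have "G (B $$ (i mod M, j mod M) \<cdot>\<^sub>m A) = B $$ (i mod M, j mod M) \<cdot>\<^sub>m G A"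
      using G A unfolding superoperator_def by auto
    then show "tensor_id M G (kronecker A B) $$ (i, j) = kronecker (G A) B $$ (i, j)"
      using b d GA A B block[OF M] by (simp add: tensor_id_def) (simp add: kronecker_def)
  qed (use GA A B in \<open>auto simp: tensor_id_def kronecker_def\<close>)
qed

definition cpso :: "(complex mat \<Rightarrow> complex mat) \<Rightarrow> bool" where
  "cpso G \<longleftrightarrow> superoperator 2 G \<and> (\<forall>M>0. pso (2 * M) (tensor_id M G))"

abbreviation ket0 :: "complex vec" where "ket0 \<equiv> unit_vec 2 0"
abbreviation ket1 :: "complex vec" where "ket1 \<equiv> unit_vec 2 1"

definition proj :: "complex vec \<Rightarrow> complex mat" where
  "proj v = mat (dim_vec v) (dim_vec v) (\<lambda>(i, j). v $ i * cnj (v $ j))"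

definition Pr0 :: "complex mat \<Rightarrow> complex" where
  "Pr0 \<rho> = (\<rho> *\<^sub>v ket0) \<bullet>c ket0"

definition unitary_mat :: "nat \<Rightarrow> complex mat \<Rightarrow> bool" where
  "unitary_mat n U \<longleftrightarrow>
     U \<in> carrier_mat n n \<and> mat_adjoint U * U = 1\<^sub>m n \<and> U * mat_adjoint U = 1\<^sub>m n"

definition unitary_superop :: "complex mat \<Rightarrow> (complex mat \<Rightarrow> complex mat)" where
  "unitary_superop A = (\<lambda>\<rho> \<in> carrier_mat 2 2. A * \<rho> * mat_adjoint A)"

definition psi :: "real \<Rightarrow> real \<Rightarrow> complex vec" where
  "psi \<theta> \<phi> = complex_of_real (cos (\<theta> / 2)) \<cdot>\<^sub>v ket0 + (cis \<phi> * complex_of_real (sin (\<theta> / 2))) \<cdot>\<^sub>v ket1"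

definition psi_perp :: "real \<Rightarrow> real \<Rightarrow> complex vec" where
  "psi_perp \<theta> \<phi> = complex_of_real (sin (\<theta> / 2)) \<cdot>\<^sub>v ket0 - (cis \<phi> * complex_of_real (cos (\<theta> / 2))) \<cdot>\<^sub>v ket1"

definition is_rotation :: "real \<Rightarrow> real \<Rightarrow> real \<Rightarrow> complex mat \<Rightarrow> bool" where
  "is_rotation \<alpha> \<theta> \<phi> U \<longleftrightarrow>
     unitary_mat 2 U \<and>
     U *\<^sub>v psi \<theta> \<phi> = psi \<theta> \<phi> \<and>
     U *\<^sub>v psi_perp \<theta> \<phi> = cis \<alpha> \<cdot>\<^sub>v psi_perp \<theta> \<phi>"

definition rotation :: "real \<Rightarrow> real \<Rightarrow> real \<Rightarrow> complex mat" where
  "rotation \<alpha> \<theta> \<phi> = (THE U. is_rotation \<alpha> \<theta> \<phi> U)"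

lemma adj2:
  assumes "A \<in> carrier_mat 2 2"
  shows "mat_adjoint A = mat 2 2 (\<lambda>(i, j). cnj (A $$ (j, i)))"
  using assms by (auto simp: mat_adjoint_def mat_of_rows_def)

lemma ex1_rotation: "\<exists>!U. is_rotation \<alpha> \<theta> \<phi> U"
proof -
  define c where "c = complex_of_real (cos (\<theta> / 2))"
  define s where "s = complex_of_real (sin (\<theta> / 2))"
  define p where "p = cis \<phi>"
  define q where "q = cnj p"
  define w where "w = cis \<alpha>"
  define z where "z = cnj w"
  have cs: "c * c + s * s = 1"
    unfolding c_def s_def
    by (metis of_real_1 of_real_add of_real_mult power2_eq_square sin_cos_squared_add2)
  have pq: "p * q = 1" and wz: "w * z = 1"
    by (simp_all add: p_def q_def w_def z_def cis_cnj cis_mult)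
  have zw: "z * w = 1" using wz by (simp add: mult.commute)
  have diag: "(c * c + y * (s * s)) * (c * c + x * (s * s)) +
                q * c * s * (1 - y) * (p * c * s * (1 - x)) = 1"
             "p * c * s * (1 - y) * (q * c * s * (1 - x)) +
                (s * s + y * (c * c)) * (s * s + x * (c * c)) = 1"
    if xy: "x * y = 1" for x y
  proof -
    have "(c * c + y * (s * s)) * (c * c + x * (s * s)) +
            q * c * s * (1 - y) * (p * c * s * (1 - x)) =
          (c * c + s * s)\<^sup>2 + (x * y - 1) * (s * s) * (s * s + c * c)
            + (p * q - 1) * (c * c) * (s * s) * ((1 - x) * (1 - y))"
      by (simp_all add: algebra_simps power2_eq_square)
    then show "(c * c + y * (s * s)) * (c * c + x * (s * s)) +
            q * c * s * (1 - y) * (p * c * s * (1 - x)) = 1"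
      by (simp add: cs pq xy)
    have "p * c * s * (1 - y) * (q * c * s * (1 - x)) +
            (s * s + y * (c * c)) * (s * s + x * (c * c)) =
          (c * c + s * s)\<^sup>2 + (x * y - 1) * (c * c) * (s * s + c * c)
            + (p * q - 1) * (c * c) * (s * s) * ((1 - x) * (1 - y))"
      by (simp_all add: algebra_simps power2_eq_square)
    then show "p * c * s * (1 - y) * (q * c * s * (1 - x)) +
            (s * s + y * (c * c)) * (s * s + x * (c * c)) = 1"
      by (simp add: cs pq xy)
  qed
  have off: "(c * c + y * (s * s)) * (r * c * s * (1 - x)) +
               r * c * s * (1 - y) * (s * s + x * (c * c)) = 0"
            "r * c * s * (1 - y) * (c * c + x * (s * s)) +
               (s * s + y * (c * c)) * (r * c * s * (1 - x)) = 0"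
    if xy: "x * y = 1" for x y r
  proof -
    have "(c * c + y * (s * s)) * (r * c * s * (1 - x)) +
            r * c * s * (1 - y) * (s * s + x * (c * c)) =
          r * c * s * (c * c + s * s) * (1 - x * y)"
      by (simp_all add: algebra_simps power2_eq_square)
    then show "(c * c + y * (s * s)) * (r * c * s * (1 - x)) +
            r * c * s * (1 - y) * (s * s + x * (c * c)) = 0"
      by (simp add: xy)
    have "r * c * s * (1 - y) * (c * c + x * (s * s)) +
            (s * s + y * (c * c)) * (r * c * s * (1 - x)) =
          r * c * s * (c * c + s * s) * (1 - x * y)"
      by (simp_all add: algebra_simps power2_eq_square)
    then show "r * c * s * (1 - y) * (c * c + x * (s * s)) +
            (s * s + y * (c * c)) * (r * c * s * (1 - x)) = 0"
      by (simp add: xy)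
  qed
  have "(c * c + w * (s * s)) * c + q * c * s * (1 - w) * (p * s) =
        c * (c * c + s * s) + (p * q - 1) * c * (s * s) * (1 - w)"
       "p * c * s * (1 - w) * c + (s * s + w * (c * c)) * (p * s) = p * s * (c * c + s * s)"
    by (simp_all add: algebra_simps power2_eq_square)
  then have fixv: "(c * c + w * (s * s)) * c + q * c * s * (1 - w) * (p * s) = c"
                  "p * c * s * (1 - w) * c + (s * s + w * (c * c)) * (p * s) = p * s"
    by (simp_all add: cs pq)
  have "(c * c + w * (s * s)) * s - q * c * s * (1 - w) * (p * c) =
        w * s * (c * c + s * s) - (p * q - 1) * s * (c * c) * (1 - w)"
       "p * c * s * (1 - w) * s - (s * s + w * (c * c)) * (p * c) =
        - (w * (p * c)) * (c * c + s * s)"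
    by (simp_all add: algebra_simps power2_eq_square)
  then have eigv: "(c * c + w * (s * s)) * s - q * c * s * (1 - w) * (p * c) = w * s"
                  "p * c * s * (1 - w) * s - (s * s + w * (c * c)) * (p * c) = - (w * (p * c))"
    by (simp_all add: cs pq)
  have solve: "x = c * a + s * b" "y = q * (s * a - c * b)"
    if "x * c + y * (p * s) = a" "x * s - y * (p * c) = b" for x y a b
  proof -
    have "c * (x * c + y * (p * s)) + s * (x * s - y * (p * c)) = x * (c * c + s * s)"
         "q * (s * (x * c + y * (p * s)) - c * (x * s - y * (p * c))) =
            y * (p * q) * (c * c + s * s)"
      by (simp_all add: algebra_simps power2_eq_square)
    then show "x = c * a + s * b" "y = q * (s * a - c * b)"
      unfolding that by (simp_all add: cs pq)
  qed
  have cnjs: "cnj c = c" "cnj s = s" "cnj p = q" "cnj q = p" "cnj w = z" "cnj z = w"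
    by (simp_all add: c_def s_def q_def z_def)
  have psi: "psi \<theta> \<phi> = vec 2 (\<lambda>i. if i = 0 then c else p * s)"
    and perp: "psi_perp \<theta> \<phi> = vec 2 (\<lambda>i. if i = 0 then s else - (p * c))"
    by (auto simp: psi_def psi_perp_def c_def s_def p_def less_2_cases_iff)
  define U where "U = mat 2 2 (\<lambda>(i, j).
     if i = 0 then (if j = 0 then c * c + w * (s * s) else q * c * s * (1 - w))
     else (if j = 0 then p * c * s * (1 - w) else s * s + w * (c * c)))"
  note S = scalar_prod_def numeral_2_eq_2 sum.atLeast0_lessThan_Suc
  have U: "U \<in> carrier_mat 2 2" by (simp add: U_def)
  have ex: "is_rotation \<alpha> \<theta> \<phi> U"
    unfolding is_rotation_def unitary_mat_def adj2[OF U] psi perp w_def[symmetric]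
  proof (intro conjI)
    show "mat 2 2 (\<lambda>(i, j). cnj (U $$ (j, i))) * U = 1\<^sub>m 2"
      by (intro eq_matI)
        (auto simp: U_def S less_Suc_eq cnjs diag[OF wz] off[OF wz])
    show "U * mat 2 2 (\<lambda>(i, j). cnj (U $$ (j, i))) = 1\<^sub>m 2"
      by (intro eq_matI)
        (auto simp: U_def S less_Suc_eq cnjs diag[OF zw] off[OF zw])
    show "U *\<^sub>v vec 2 (\<lambda>i. if i = 0 then c else p * s) = vec 2 (\<lambda>i. if i = 0 then c else p * s)"
      using fixv by (intro eq_vecI) (auto simp: U_def S less_Suc_eq)
    show "U *\<^sub>v vec 2 (\<lambda>i. if i = 0 then s else - (p * c)) =
          w \<cdot>\<^sub>v vec 2 (\<lambda>i. if i = 0 then s else - (p * c))"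
      using eigv by (intro eq_vecI) (auto simp: U_def S less_Suc_eq)
  qed (rule U)
  have uniq: "V = U" if V: "is_rotation \<alpha> \<theta> \<phi> V" for V
  proof -
    have V2: "V \<in> carrier_mat 2 2" using V by (simp add: is_rotation_def unitary_mat_def)
    have row: "V $$ (i, 0) * c + V $$ (i, 1) * (p * s) = (if i = 0 then c else p * s)"
              "V $$ (i, 0) * s - V $$ (i, 1) * (p * c) = w * (if i = 0 then s else - (p * c))"
      if i: "i < 2" for i
    proof -
      have "(V *\<^sub>v psi \<theta> \<phi>) $ i = psi \<theta> \<phi> $ i"
           "(V *\<^sub>v psi_perp \<theta> \<phi>) $ i = (cis \<alpha> \<cdot>\<^sub>v psi_perp \<theta> \<phi>) $ i"
        using V by (simp_all add: is_rotation_def)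
      then show "V $$ (i, 0) * c + V $$ (i, 1) * (p * s) = (if i = 0 then c else p * s)"
              "V $$ (i, 0) * s - V $$ (i, 1) * (p * c) = w * (if i = 0 then s else - (p * c))"
        using V2 i by (simp_all add: psi perp S w_def)
    qed
    have r0: "V $$ (0, 0) * c + V $$ (0, 1) * (p * s) = c"
             "V $$ (0, 0) * s - V $$ (0, 1) * (p * c) = w * s"
      using row[of 0] by simp_all
    have r1: "V $$ (1, 0) * c + V $$ (1, 1) * (p * s) = p * s"
             "V $$ (1, 0) * s - V $$ (1, 1) * (p * c) = - (w * (p * c))"
      using row[of 1] by simp_all
    have "q * (s * (p * s) - c * - (w * (p * c))) = p * q * (s * s + w * (c * c))"
      by (simp add: algebra_simps)
    then have v11: "V $$ (1, 1) = s * s + w * (c * c)"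
      using solve(2)[OF r1] pq by simp
    have e: "V $$ (0, 0) = c * c + w * (s * s)" "V $$ (0, 1) = q * c * s * (1 - w)"
            "V $$ (1, 0) = p * c * s * (1 - w)" "V $$ (1, 1) = s * s + w * (c * c)"
      using solve[OF r0] solve(1)[OF r1] v11 by (simp_all add: algebra_simps)
    show "V = U"
      using V2 e by (intro eq_matI) (auto simp: U_def less_2_cases_iff)
  qed
  show ?thesis using ex uniq by blast
qed

definition rotation_family :: "real \<Rightarrow> real \<Rightarrow> (complex mat \<Rightarrow> complex mat) set" where
  "rotation_family \<alpha> \<theta> =
     {G. \<exists>\<phi> \<in> {0..<2 * pi}. G = unitary_superop (rotation \<alpha> \<theta> \<phi>) \<or>
                           G = unitary_superop (rotation (- \<alpha>) \<theta> \<phi>)}"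

definition n_alpha :: "real \<Rightarrow> nat" where
  "n_alpha \<alpha> = (LEAST n. 0 < n \<and> [real n * \<alpha> = 0] (rmod (2 * pi)))"

definition z_coeff :: "nat \<Rightarrow> real \<Rightarrow> real \<Rightarrow> real" where
  "z_coeff k \<alpha> \<theta> = (cos \<theta>)\<^sup>2 + (sin \<theta>)\<^sup>2 * cos (real k * \<alpha>)"

end

theory Submission
  imports Defs
begin

text \<open>
  The equations say that \<open>G\<^sup>n\<close> perfectly distinguishes the two basis states. A state that some
  later measurement distinguishes perfectly from another one is pure, and the other one is
  orthogonal to it; hence \<open>G\<close> maps the basis projections to \<open>e e\<^sup>*\<close> and \<open>f f\<^sup>*\<close> with \<open>e\<close>, \<open>f\<close>
  orthonormal. Positivity of the Choi matrix then gives \<open>G(|0><1|) = c e f\<^sup>*\<close>, and since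
  \<open>G\<^sup>2(|0><0|)\<close> is pure too, while \<open>e\<close> is not a basis vector (this is where
  \<open>(\<alpha>, \<theta>) \<noteq> (\<pi>, \<pi>/2)\<close> enters), \<open>|c| = 1\<close>. So \<open>G\<close> is conjugation by
  some \<open>U \<in> SU(2)\<close>, and the equations for \<open>k = 1, 2\<close> already determine \<open>|U\<^sub>0\<^sub>0|\<close> and
  \<open>|Re U\<^sub>0\<^sub>0|\<close>, that is, the axis angle \<open>\<theta>\<close> and the rotation angle \<open>\<alpha>\<close> up to sign.
\<close>

section \<open>Qubit states in coordinates\<close>

definition mat2 :: "complex \<Rightarrow> complex \<Rightarrow> complex \<Rightarrow> complex \<Rightarrow> complex mat" where
  "mat2 a b c d =
     mat 2 2 (\<lambda>(i, j). if i = 0 then (if j = 0 then a else b) else (if j = 0 then c else d))"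

lemma mat2_carrier [simp]: "mat2 a b c d \<in> carrier_mat 2 2"
  and dim_mat2 [simp]: "dim_row (mat2 a b c d) = 2" "dim_col (mat2 a b c d) = 2"
  by (simp_all add: mat2_def)

text \<open>Indices are spelled \<open>Suc 0\<close> because the simplifier rewrites the natural
  number \<open>1\<close> to that form.\<close>

lemma mat2_index [simp]:
  "mat2 a b c d $$ (0, 0) = a" "mat2 a b c d $$ (0, Suc 0) = b"
  "mat2 a b c d $$ (Suc 0, 0) = c" "mat2 a b c d $$ (Suc 0, Suc 0) = d"
  by (simp_all add: mat2_def)

lemma mat2_eq_iff: "mat2 a b c d = mat2 a' b' c' d' \<longleftrightarrow> a = a' \<and> b = b' \<and> c = c' \<and> d = d'"
  by (metis mat2_index)

lemma mat2_eta:
  assumes "X \<in> carrier_mat 2 2"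
  shows "X = mat2 (X $$ (0, 0)) (X $$ (0, 1)) (X $$ (1, 0)) (X $$ (1, 1))"
  using assms by (intro eq_matI) (auto simp: less_2_cases_iff)

lemma mat2_add [simp]:
  "mat2 a b c d + mat2 a' b' c' d' = mat2 (a + a') (b + b') (c + c') (d + d')"
  by (intro eq_matI) (auto simp: less_2_cases_iff)

lemma mat2_smult [simp]: "x \<cdot>\<^sub>m mat2 a b c d = mat2 (x * a) (x * b) (x * c) (x * d)"
  by (intro eq_matI) (auto simp: less_2_cases_iff)

lemma mat2_mult [simp]:
  "mat2 a b c d * mat2 a' b' c' d' =
     mat2 (a * a' + b * c') (a * b' + b * d') (c * a' + d * c') (c * b' + d * d')"
  by (intro eq_matI)
    (auto simp: less_Suc_eq scalar_prod_def numeral_2_eq_2 sum.atLeast0_lessThan_Suc)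

lemma mat2_adjoint [simp]: "mat_adjoint (mat2 a b c d) = mat2 (cnj a) (cnj c) (cnj b) (cnj d)"
  unfolding adj2[OF mat2_carrier] by (intro eq_matI) (auto simp: less_2_cases_iff)

lemma one_mat2: "1\<^sub>m 2 = mat2 1 0 0 1"
  by (intro eq_matI) (auto simp: less_2_cases_iff)

lemma Pr0_mat2 [simp]: "Pr0 (mat2 a b c d) = a"
  by (auto simp: Pr0_def scalar_prod_def numeral_2_eq_2 sum.atLeast0_lessThan_Suc)

lemma proj_ket0: "proj ket0 = mat2 1 0 0 0" and proj_ket1: "proj ket1 = mat2 0 0 0 1"
  by (rule eq_matI; auto simp: proj_def less_2_cases_iff)+

lemma quadratic_form_mat2:
  assumes "v \<in> carrier_vec 2"
  shows "(mat2 a b c d *\<^sub>v v) \<bullet>c v =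
    a * v $ 0 * cnj (v $ 0) + b * v $ 1 * cnj (v $ 0)
      + c * v $ 0 * cnj (v $ 1) + d * v $ 1 * cnj (v $ 1)"
  using assms
  by (auto simp: scalar_prod_def numeral_2_eq_2 sum.atLeast0_lessThan_Suc algebra_simps)

text \<open>Affine coordinates on the Hermitian matrices of trace 1: the Bloch vector is (2 Re q, -2
  Im q, 2p - 1) and the determinant is p (1 - p) - |q|^2. The Bloch ball is thus |q|^2 \<le> p (1 -
  p), with equality exactly at the pure states.\<close>

definition state :: "real \<Rightarrow> complex \<Rightarrow> complex mat" where
  "state p q = mat2 (of_real p) q (cnj q) (of_real (1 - p))"

lemma density_matrixD:
  assumes "density_matrix 2 \<rho>"
  obtains p q where "\<rho> = state p q" "(cmod q)\<^sup>2 \<le> p * (1 - p)"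
proof -
  obtain a b c d where \<rho>: "\<rho> = mat2 a b c d"
    using assms mat2_eta unfolding density_matrix_def by blast
  have sa: "cnj a = a" "cnj c = b" "cnj b = c" "cnj d = d" "a + d = 1"
    using assms by (simp_all add: density_matrix_def \<rho> mat2_eq_iff numeral_2_eq_2)
  define p where "p = Re a"
  have ap: "a = of_real p" using sa(1) by (simp add: p_def complex_eq_iff)
  have dp: "d = of_real (1 - p)" using sa(5) ap by (simp add: algebra_simps)
  have form: "0 \<le> p * (cmod x)\<^sup>2 + 2 * Re (b * y * cnj x) + (1 - p) * (cmod y)\<^sup>2" for x y
  proof -
    let ?v = "vec 2 (\<lambda>i. if i = 0 then x else y)"
    have "0 \<le> Re ((\<rho> *\<^sub>v ?v) \<bullet>c ?v)"
      using assms unfolding density_matrix_def by simp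
    also have "\<dots> = p * (cmod x)\<^sup>2 + 2 * Re (b * y * cnj x) + (1 - p) * (cmod y)\<^sup>2"
      unfolding \<rho> quadratic_form_mat2[OF vec_carrier] ap dp sa(3)[symmetric] cmod_power2
      by (simp add: algebra_simps power2_eq_square)
    finally show ?thesis .
  qed
  have p0: "0 \<le> p" using form[of 1 0] by simp
  have p1: "0 \<le> 1 - p" using form[of 0 1] by simp
  have "(cmod b)\<^sup>2 \<le> p * (1 - p)"
  proof (cases "p = 0")
    case True
    show ?thesis
    proof (cases "b = 0")
      case False
      \<comment> \<open>For p = 0 the form takes the negative value -2 + 1 at the vector (- b /
        |b|^2, 1).\<close>
      have "0 \<le> 2 * Re (b * 1 * cnj (- (b / of_real ((cmod b)\<^sup>2)))) + 1"
        using form[of "- (b / of_real ((cmod b)\<^sup>2))" 1] \<open>p = 0\<close> by simp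
      also have "b * 1 * cnj (- (b / of_real ((cmod b)\<^sup>2))) = - 1"
        using False by (simp add: complex_norm_square del: of_real_power)
      finally show ?thesis by simp
    qed (use p0 p1 in simp)
  next
    case False
    then have pp: "p > 0" using p0 by simp
    \<comment> \<open>With second entry p, the form is smallest at first entry - b; its value there
      is p times the determinant.\<close>
    have "0 \<le> p * (cmod (- b))\<^sup>2 + 2 * Re (b * of_real p * cnj (- b)) + (1 - p) * (cmod (of_real p))\<^sup>2"
      by (rule form)
    also have "\<dots> = p * (p * (1 - p) - (cmod b)\<^sup>2)"
      unfolding norm_minus_cancel norm_of_real cmod_power2
      by (simp add: power2_eq_square algebra_simps)
    finally show ?thesis using pp by (simp add: zero_le_mult_iff)
  qed
  with that[of p b] show ?thesis unfolding \<rho> state_def ap dp sa(3)[symmetric] by simp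
qed

text \<open>Bounding the cross term by 2 sqrt (p (1 - p)) |x| |y| leaves the square of sqrt p |x| -
  sqrt (1 - p) |y| as a lower bound of the form.\<close>

lemma density_matrix_state:
  assumes "(cmod q)\<^sup>2 \<le> p * (1 - p)"
  shows "density_matrix 2 (state p q)"
proof -
  have "0 \<le> p * (1 - p)" using assms zero_le_power2 order_trans by blast
  then have p: "0 \<le> p" "0 \<le> 1 - p" by (auto simp: zero_le_mult_iff)
  have "0 \<le> Re ((state p q *\<^sub>v v) \<bullet>c v)" if v: "v \<in> carrier_vec 2" for v
  proof -
    define x y where "x = v $ 0" and "y = v $ 1"
    have "cmod q \<le> sqrt p * sqrt (1 - p)"
      using assms p by (metis real_le_rsqrt real_sqrt_mult)
    then have "cmod q * cmod y * cmod x \<le> (sqrt p * sqrt (1 - p)) * cmod y * cmod x"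
      by (intro mult_right_mono) auto
    moreover have "0 \<le> (sqrt p * cmod x - sqrt (1 - p) * cmod y)\<^sup>2" by simp
    moreover have "\<dots> = p * (cmod x)\<^sup>2 + (1 - p) * (cmod y)\<^sup>2
        - 2 * ((sqrt p * sqrt (1 - p)) * cmod y * cmod x)"
      using p by (simp add: power2_diff power_mult_distrib)
    moreover have "- Re (q * y * cnj x) \<le> cmod q * cmod y * cmod x"
      by (metis abs_Re_le_cmod abs_le_iff complex_mod_cnj norm_mult)
    moreover have "Re ((state p q *\<^sub>v v) \<bullet>c v)
        = p * (cmod x)\<^sup>2 + 2 * Re (q * y * cnj x) + (1 - p) * (cmod y)\<^sup>2"
      unfolding state_def quadratic_form_mat2[OF v] x_def y_def cmod_power2
      by (simp add: algebra_simps power2_eq_square)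
    ultimately show ?thesis by linarith
  qed
  then show ?thesis
    by (simp add: density_matrix_def state_def mat2_eq_iff numeral_2_eq_2
        del: dim_mat2 mat2_carrier) (simp flip: numeral_2_eq_2)
qed

section \<open>Perfectly distinguishable states\<close>

text \<open>An affine function on a ball that is not constant attains its maximum only on the
  sphere. Here \<open>h\<close> stands for the probability of an outcome; \<open>affine\<close> is
  required for all real \<open>t\<close>, since the proof extrapolates beyond the given
  state.\<close>

lemma certain_outcome_imp_pure:
  fixes h :: "real \<Rightarrow> complex \<Rightarrow> real"
  assumes affine: "\<And>t p q p' q'.
      h ((1 - t) * p + t * p') (of_real (1 - t) * q + of_real t * q') = (1 - t) * h p q + t * h p' q'"
    and bound: "\<And>p q. (cmod q)\<^sup>2 \<le> p * (1 - p) \<Longrightarrow> h p q \<le> 1"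
    and centre: "h (1 / 2) 0 = 1 / 2"
    and state: "(cmod q)\<^sup>2 \<le> p * (1 - p)" and certain: "h p q = 1"
  shows "(cmod q)\<^sup>2 = p * (1 - p)"
proof (rule ccontr)
  assume neq: "\<not> ?thesis"
  \<comment> \<open>\<open>r\<close> is the length of the Bloch vector; if \<open>r < 1\<close>, stretching it to length 1 pushes \<open>h\<close> above 1.\<close>
  define r where "r = sqrt ((2 * p - 1)\<^sup>2 + 4 * (cmod q)\<^sup>2)"
  have r2: "r\<^sup>2 = (2 * p - 1)\<^sup>2 + 4 * (cmod q)\<^sup>2" by (simp add: r_def)
  have "(2 * p - 1)\<^sup>2 + 4 * (cmod q)\<^sup>2 < 1"
    using state neq by (simp add: power2_eq_square algebra_simps)
  then have r1: "r < 1" by (simp add: r_def)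
  have r0: "r > 0"
  proof -
    have "\<not> (p = 1 / 2 \<and> q = 0)"
    proof
      assume "p = 1 / 2 \<and> q = 0"
      then have "h p q = h (1 / 2) 0" by (simp only:)
      then show False using certain centre by linarith
    qed
    then have "(2 * p - 1)\<^sup>2 > 0 \<or> (cmod q)\<^sup>2 > 0" by auto
    then have "(2 * p - 1)\<^sup>2 + 4 * (cmod q)\<^sup>2 > 0"
      by (smt (verit) zero_le_power2)
    then show ?thesis by (simp add: r_def)
  qed
  define t where "t = 1 / r"
  have t1: "t > 1" and tr: "t\<^sup>2 * r\<^sup>2 = 1" using r0 r1 by (simp_all add: t_def power_divide)
  have "h ((1 - t) * (1 / 2) + t * p) (of_real (1 - t) * 0 + of_real t * q) \<le> 1"
  proof (rule bound)
    have "(cmod (of_real (1 - t) * 0 + of_real t * q))\<^sup>2 = t\<^sup>2 * (cmod q)\<^sup>2"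
      by (simp add: norm_mult power_mult_distrib)
    also have "\<dots> = (t\<^sup>2 * r\<^sup>2 - t\<^sup>2 * (2 * p - 1)\<^sup>2) / 4" by (simp add: r2 algebra_simps)
    also have "\<dots> = ((1 - t) * (1 / 2) + t * p) * (1 - ((1 - t) * (1 / 2) + t * p))"
      unfolding tr by (simp add: field_simps power2_eq_square)
    finally show "(cmod (of_real (1 - t) * 0 + of_real t * q))\<^sup>2
        \<le> ((1 - t) * (1 / 2) + t * p) * (1 - ((1 - t) * (1 / 2) + t * p))" by simp
  qed
  \<comment> \<open>By affinity the value at the stretched point is (1 - t) / 2 + t = (1 + t) / 2,
    which exceeds 1.\<close>
  then show False unfolding affine centre certain using t1 by (simp add: field_simps)
qed

text \<open>The values at antipodal points average to the value at the centre, which the two given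
  states force to be 1/2. So the first state and the antipode of the second are both certain, and so
  is their midpoint. All three then lie on the sphere, which contains no proper segment.\<close>

lemma distinguishable_imp_antipodal:
  fixes h :: "real \<Rightarrow> complex \<Rightarrow> real"
  assumes affine: "\<And>t p q p' q'.
      h ((1 - t) * p + t * p') (of_real (1 - t) * q + of_real t * q') = (1 - t) * h p q + t * h p' q'"
    and bound: "\<And>p q. (cmod q)\<^sup>2 \<le> p * (1 - p) \<Longrightarrow> 0 \<le> h p q \<and> h p q \<le> 1"
    and state: "(cmod q)\<^sup>2 \<le> p * (1 - p)" "(cmod q')\<^sup>2 \<le> p' * (1 - p')"
    and h: "h p q = 1" "h p' q' = 0"
  shows "(cmod q)\<^sup>2 = p * (1 - p)" "p' = 1 - p" "q' = - q"
proof -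
  have half: "h ((x + y) / 2) ((u + v) / 2) = (h x u + h y v) / 2" for x y u v
    using affine[of "1/2" x y u v] by (simp add: field_simps)
  have mid: "h (1 / 2) 0 = (h x u + h (1 - x) (- u)) / 2" for x u
    using half[of x "1 - x" u "- u"] by simp
  \<comment> \<open>The first bound makes the centre at least 1/2, the second at most 1/2.\<close>
  have "0 \<le> h (1 - p) (- q)" "h (1 - p') (- q') \<le> 1"
    using bound[of "- q" "1 - p"] bound[of "- q'" "1 - p'"] state by (auto simp: mult.commute)
  then have centre: "h (1 / 2) 0 = 1 / 2"
    using mid[of p q] mid[of p' q'] unfolding h by argo
  have h': "h (1 - p') (- q') = 1" using mid[of p' q'] centre h by simp
  note pure = certain_outcome_imp_pure[of h, OF affine _ centre]
  show q: "(cmod q)\<^sup>2 = p * (1 - p)" using pure bound state h by blast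
  have q': "(cmod q')\<^sup>2 = p' * (1 - p')"
    using pure[of "- q'" "1 - p'"] bound state h' by (simp add: mult.commute)
  define P Q where "P = (p + (1 - p')) / 2" and "Q = (q + - q') / 2"
  \<comment> \<open>Parallelogram law: the midpoint of two pure states misses the sphere by an
    amount that vanishes only if the states coincide.\<close>
  have par: "P * (1 - P) - (cmod Q)\<^sup>2
      = ((p - (1 - p')) / 2)\<^sup>2 + (cmod ((q + q') / 2))\<^sup>2"
  proof -
    have "P * (1 - P) - (cmod Q)\<^sup>2 - ((p - (1 - p')) / 2)\<^sup>2 - (cmod ((q + q') / 2))\<^sup>2
        = (p * (1 - p) - (cmod q)\<^sup>2) / 2 + (p' * (1 - p') - (cmod q')\<^sup>2) / 2"
      unfolding P_def Q_def cmod_power2 by (simp add: field_simps power2_eq_square)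
    then show ?thesis using q q' by simp
  qed
  have "h P Q = 1" unfolding P_def Q_def half using h h' by simp
  moreover have "(cmod Q)\<^sup>2 \<le> P * (1 - P)" using par by (smt (verit) zero_le_power2)
  ultimately have "(cmod Q)\<^sup>2 = P * (1 - P)" using pure bound by blast
  then have "((p - (1 - p')) / 2)\<^sup>2 + (cmod ((q + q') / 2))\<^sup>2 = 0" using par by simp
  then have "p - (1 - p') = 0" "q + q' = 0"
    by (simp_all add: sum_power2_eq_zero_iff)
  then show "p' = 1 - p" "q' = - q" by (simp_all add: algebra_simps eq_neg_iff_add_eq_0)
qed

section \<open>The Choi matrix\<close>

lemma
  assumes "superoperator n G" "X \<in> carrier_mat n n"
  shows superoperator_carrier: "G X \<in> carrier_mat n n"
    and superoperator_add: "Y \<in> carrier_mat n n \<Longrightarrow> G (X + Y) = G X + G Y"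
    and superoperator_smult: "G (c \<cdot>\<^sub>m X) = c \<cdot>\<^sub>m G X"
proof -
  have G: "G \<in> carrier_mat n n \<rightarrow>\<^sub>E carrier_mat n n"
    and add: "\<forall>X \<in> carrier_mat n n. \<forall>Y \<in> carrier_mat n n. G (X + Y) = G X + G Y"
    and smult: "\<forall>c. \<forall>X \<in> carrier_mat n n. G (c \<cdot>\<^sub>m X) = c \<cdot>\<^sub>m G X"
    using assms(1) unfolding superoperator_def by iprover+
  show "G X \<in> carrier_mat n n" using G assms(2) by (rule PiE_mem)
  show "G (X + Y) = G X + G Y" if "Y \<in> carrier_mat n n"
    using add assms(2) that by blast
  show "G (c \<cdot>\<^sub>m X) = c \<cdot>\<^sub>m G X" using smult assms(2) by blast
qed

lemma superoperator_mat2: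
  assumes "superoperator 2 G"
  shows "G (mat2 a b c d) = a \<cdot>\<^sub>m G (mat2 1 0 0 0) + b \<cdot>\<^sub>m G (mat2 0 1 0 0)
           + c \<cdot>\<^sub>m G (mat2 0 0 1 0) + d \<cdot>\<^sub>m G (mat2 0 0 0 1)"
proof -
  \<comment> \<open>In \<open>c'\<close> the matrix \<open>X\<close> is arbitrary because a sum of
    matrices takes its dimensions from the second summand.\<close>
  have c: "x \<cdot>\<^sub>m mat2 a b c d \<in> carrier_mat 2 2"
    and c': "X + x \<cdot>\<^sub>m mat2 a b c d \<in> carrier_mat 2 2" for X x a b c d
    by simp_all
  have "G (a \<cdot>\<^sub>m mat2 1 0 0 0 + b \<cdot>\<^sub>m mat2 0 1 0 0 + c \<cdot>\<^sub>m mat2 0 0 1 0 + d \<cdot>\<^sub>m mat2 0 0 0 1)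
      = a \<cdot>\<^sub>m G (mat2 1 0 0 0) + b \<cdot>\<^sub>m G (mat2 0 1 0 0)
           + c \<cdot>\<^sub>m G (mat2 0 0 1 0) + d \<cdot>\<^sub>m G (mat2 0 0 0 1)"
    unfolding superoperator_add[OF assms c' c] superoperator_add[OF assms c c]
      superoperator_smult[OF assms mat2_carrier] ..
  moreover have "a \<cdot>\<^sub>m mat2 1 0 0 0 + b \<cdot>\<^sub>m mat2 0 1 0 0 + c \<cdot>\<^sub>m mat2 0 0 1 0 + d \<cdot>\<^sub>m mat2 0 0 0 1
      = mat2 a b c d"
    by simp
  ultimately show ?thesis by (simp only:)
qed

text \<open>Near 0 a linear term outweighs a quadratic one. This extracts linear equations from
  positivity of the Choi matrix at vectors that annihilate one of its diagonal blocks.\<close>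

lemma quadratic_nonneg_imp_linear_zero:
  fixes z :: complex
  assumes "\<And>u. 0 \<le> s * (cmod u)\<^sup>2 + 2 * Re (u * z)"
  shows "z = 0"
proof (rule ccontr)
  assume z: "z \<noteq> 0"
  \<comment> \<open>Any positive k with s < 2 k would do: at u = - cnj z / k the expression is |z|^2
    (s - 2 k) / k^2.\<close>
  define k where "k = \<bar>s\<bar> + 1"
  have k: "k > 0" "s < 2 * k" by (simp_all add: k_def)
  have "0 \<le> s * (cmod (- cnj z / of_real k))\<^sup>2 + 2 * Re (- cnj z / of_real k * z)" by (rule assms)
  also have "(cmod (- cnj z / of_real k))\<^sup>2 = (cmod z)\<^sup>2 / k\<^sup>2"
    using k by (simp add: norm_divide power_divide)
  also have "- cnj z / of_real k * z = of_real (- (cmod z)\<^sup>2 / k)"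
    by (simp only: of_real_divide of_real_minus complex_norm_square) simp
  also have "s * ((cmod z)\<^sup>2 / k\<^sup>2) + 2 * Re (of_real (- (cmod z)\<^sup>2 / k)) = (cmod z)\<^sup>2 * (s - 2 * k) / k\<^sup>2"
    using k by (simp only: Re_complex_of_real) (simp add: field_simps power2_eq_square)
  finally have "0 \<le> (cmod z)\<^sup>2 * (s - 2 * k)" using k by (simp add: zero_le_divide_iff)
  then show False using z k by (simp add: zero_le_mult_iff)
qed

text \<open>Complete positivity is applied with a second qubit to a maximally entangled state. The
  image is half the Choi matrix, with blocks G(|k><l|). Its being Hermitian gives the first claim,
  its positivity the second.\<close>

lemma choi_form:
  assumes cp: "cpso G"
    and A: "G (mat2 1 0 0 0) = state p q" and D: "G (mat2 0 0 0 1) = state p' q'"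
    and B: "G (mat2 0 1 0 0) = mat2 b00 b01 b10 b11"
  shows "G (mat2 0 0 1 0) = mat2 (cnj b00) (cnj b10) (cnj b01) (cnj b11)"
    and "0 \<le> p * (cmod x)\<^sup>2 + 2 * Re (q * y * cnj x) + (1 - p) * (cmod y)\<^sup>2
      + (p' * (cmod u)\<^sup>2 + 2 * Re (q' * v * cnj u) + (1 - p') * (cmod v)\<^sup>2)
      + 2 * Re (u * (b00 * cnj x + b10 * cnj y) + v * (b01 * cnj x + b11 * cnj y))"
proof -
  have so: "superoperator 2 G" and pso: "pso 4 (tensor_id 2 G)"
    using cp by (auto simp: cpso_def dest: spec[of _ 2])
  have sum4: "(\<Sum>i<4. f i) = f 0 + f 1 + f 2 + f (3::nat)" for f :: "nat \<Rightarrow> complex"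
    by (simp add: numeral_eq_Suc)
  \<comment> \<open>The projection onto (|00> + |11>) / sqrt 2; the basis vectors |00> and |11> have
    indices 0 and 3.\<close>
  define \<Omega> :: "complex mat" where
    "\<Omega> = mat 4 4 (\<lambda>(i, j). if (i = 0 \<or> i = 3) \<and> (j = 0 \<or> j = 3) then 1 / 2 else 0)"
  have form4: "(M *\<^sub>v w) \<bullet>c w = (\<Sum>i<4. \<Sum>j<4. M $$ (i, j) * w $ j * cnj (w $ i))"
    if "M \<in> carrier_mat 4 4" "w \<in> carrier_vec 4" for M w
    using that by (auto simp: scalar_prod_def sum_distrib_right lessThan_atLeast0 intro!: sum.cong)
  have "density_matrix 4 \<Omega>"
    unfolding density_matrix_def
  proof (intro conjI ballI)
    show \<Omega>: "\<Omega> \<in> carrier_mat 4 4" by (simp add: \<Omega>_def)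
    show "mat_adjoint \<Omega> = \<Omega>"
      by (rule eq_matI) (auto simp: \<Omega>_def mat_adjoint_def mat_of_rows_def)
    show "(\<Sum>i<4. \<Omega> $$ (i, i)) = 1" by (simp add: sum4 \<Omega>_def)
    fix w :: "complex vec" assume w: "w \<in> carrier_vec 4"
    have "(\<Omega> *\<^sub>v w) \<bullet>c w = (w $ 0 + w $ 3) * cnj (w $ 0 + w $ 3) / 2"
      unfolding form4[OF \<Omega> w] by (simp add: sum4 \<Omega>_def field_simps)
    also have "\<dots> = of_real ((cmod (w $ 0 + w $ 3))\<^sup>2 / 2)"
      unfolding of_real_divide complex_norm_square by simp
    finally have "(\<Omega> *\<^sub>v w) \<bullet>c w = of_real ((cmod (w $ 0 + w $ 3))\<^sup>2 / 2)" .
    then show "0 \<le> Re ((\<Omega> *\<^sub>v w) \<bullet>c w)" by (simp only: Re_complex_of_real) simp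
  qed
  define M where "M = tensor_id 2 G \<Omega>"
  have dens: "density_matrix 4 M"
    using pso \<open>density_matrix 4 \<Omega>\<close> by (simp add: pso_def M_def)
  obtain c00 c01 c10 c11 where C: "G (mat2 0 0 1 0) = mat2 c00 c01 c10 c11"
    using mat2_eta superoperator_carrier[OF so mat2_carrier] by blast
  have block: "tensor_block 2 \<Omega> k l = (1 / 2) \<cdot>\<^sub>m mat2 (if k = 0 \<and> l = 0 then 1 else 0)
      (if k = 0 \<and> l = 1 then 1 else 0) (if k = 1 \<and> l = 0 then 1 else 0) (if k = 1 \<and> l = 1 then 1 else 0)"
    if "k < 2" "l < 2" for k l
    using that by (intro eq_matI) (auto simp: tensor_block_def \<Omega>_def less_2_cases_iff)
  have Mij: "M $$ (2 * a + k, 2 * b + l) = G (mat2 (if k = 0 \<and> l = 0 then 1 else 0)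
      (if k = 0 \<and> l = 1 then 1 else 0) (if k = 1 \<and> l = 0 then 1 else 0)
      (if k = 1 \<and> l = 1 then 1 else 0)) $$ (a, b) / 2"
    (is "_ = G ?E $$ _ / 2") if "a < 2" "b < 2" "k < 2" "l < 2" for a b k l
  proof -
    have "\<Omega> \<in> carrier_mat 4 4" by (simp add: \<Omega>_def)
    then have "M $$ (2 * a + k, 2 * b + l) = G (tensor_block 2 \<Omega> k l) $$ (a, b)"
      using that by (simp add: M_def tensor_id_def)
    moreover have "G (tensor_block 2 \<Omega> k l) = (1 / 2) \<cdot>\<^sub>m G ?E"
      unfolding block[OF that(3,4)] by (rule superoperator_smult[OF so mat2_carrier])
    moreover have "((1 / 2) \<cdot>\<^sub>m G ?E) $$ (a, b) = G ?E $$ (a, b) / 2"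
      using that by (subst index_smult_mat)
        (simp_all only: carrier_matD[OF superoperator_carrier[OF so mat2_carrier]] times_divide_eq_left mult_1)
    ultimately show ?thesis by (simp only:)
  qed
  have idx: "M $$ (0,0) = p / 2" "M $$ (0,1) = b00 / 2" "M $$ (0,2) = q / 2" "M $$ (0,3) = b01 / 2"
    "M $$ (1,0) = c00 / 2" "M $$ (1,1) = p' / 2" "M $$ (1,2) = c01 / 2" "M $$ (1,3) = q' / 2"
    "M $$ (2,0) = cnj q / 2" "M $$ (2,1) = b10 / 2" "M $$ (2,2) = (1 - p) / 2" "M $$ (2,3) = b11 / 2"
    "M $$ (3,0) = c10 / 2" "M $$ (3,1) = cnj q' / 2" "M $$ (3,2) = c11 / 2" "M $$ (3,3) = (1 - p') / 2"
    using Mij[of 0 0 0 0] Mij[of 0 0 0 1] Mij[of 0 1 0 0] Mij[of 0 1 0 1]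
      Mij[of 0 0 1 0] Mij[of 0 0 1 1] Mij[of 0 1 1 0] Mij[of 0 1 1 1]
      Mij[of 1 0 0 0] Mij[of 1 0 0 1] Mij[of 1 1 0 0] Mij[of 1 1 0 1]
      Mij[of 1 0 1 0] Mij[of 1 0 1 1] Mij[of 1 1 1 0] Mij[of 1 1 1 1]
    by (simp_all add: A B C D state_def)
  have M4: "M \<in> carrier_mat 4 4" and adj: "mat_adjoint M = M"
    using dens by (auto simp: density_matrix_def)
  have "cnj (M $$ (j, i)) = M $$ (i, j)" if "i < 4" "j < 4" for i j
  proof -
    have "M $$ (i, j) = mat_adjoint M $$ (i, j)" by (simp add: adj)
    also have "\<dots> = cnj (M $$ (j, i))" using M4 that by (simp add: mat_adjoint_def mat_of_rows_def)
    finally show ?thesis by simp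
  qed
  \<comment> \<open>The entries of G(|1><0|) sit in odd rows and even columns, those of G(|0><1|) in
    even rows and odd columns.\<close>
  from this[of 1 0] this[of 1 2] this[of 3 0] this[of 3 2]
  have c: "c00 = cnj b00" "c01 = cnj b10" "c10 = cnj b01" "c11 = cnj b11"
    unfolding idx by simp_all
  then show "G (mat2 0 0 1 0) = mat2 (cnj b00) (cnj b10) (cnj b01) (cnj b11)" using C by simp
  \<comment> \<open>The second tensor factor varies fastest, so (x, y), paired with the block of
    |0><0|, occupies the even positions and (u, v) the odd ones. The factor 2 below clears the
    normalisation of \<open>\<Omega>\<close>.\<close>
  let ?w = "vec 4 (\<lambda>i. if i = 0 then x else if i = 1 then u else if i = 2 then y else v)"
  have "0 \<le> 2 * Re ((M *\<^sub>v ?w) \<bullet>c ?w)" using dens by (simp add: density_matrix_def)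
  also have "\<dots> = p * (cmod x)\<^sup>2 + 2 * Re (q * y * cnj x) + (1 - p) * (cmod y)\<^sup>2
      + (p' * (cmod u)\<^sup>2 + 2 * Re (q' * v * cnj u) + (1 - p') * (cmod v)\<^sup>2)
      + 2 * Re (u * (b00 * cnj x + b10 * cnj y) + v * (b01 * cnj x + b11 * cnj y))"
    unfolding form4[OF M4 vec_carrier] sum4 idx c cmod_power2
    by (simp add: idx c) (simp add: field_simps power2_eq_square)
  finally show "0 \<le> p * (cmod x)\<^sup>2 + 2 * Re (q * y * cnj x) + (1 - p) * (cmod y)\<^sup>2
      + (p' * (cmod u)\<^sup>2 + 2 * Re (q' * v * cnj u) + (1 - p') * (cmod v)\<^sup>2)
      + 2 * Re (u * (b00 * cnj x + b10 * cnj y) + v * (b01 * cnj x + b11 * cnj y))" .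
qed

text \<open>
  With \<open>\<surd>p e = (p, cnj q)\<close> and \<open>\<surd>p f = (- q, p)\<close>, the hypotheses read
  \<open>G(|0><0|) = e e\<^sup>*\<close> and \<open>G(|1><1|) = f f\<^sup>*\<close>, and the conclusion \<open>G(|0><1|) = c e f\<^sup>*\<close>.
\<close>

lemma choi_off_diagonal:
  assumes cp: "cpso G"
    and A: "G (mat2 1 0 0 0) = state p q" and D: "G (mat2 0 0 0 1) = state (1 - p) (- q)"
    and pure: "(cmod q)\<^sup>2 = p * (1 - p)" and p: "p > 0"
  obtains c where "G (mat2 0 1 0 0) = mat2 (- (c * cnj q)) (c * p) (- (c * (cnj q)\<^sup>2 / p)) (c * cnj q)"
    "G (mat2 0 0 1 0) = mat2 (- (cnj c * q)) (- (cnj c * q\<^sup>2 / p)) (cnj c * p) (cnj c * q)"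
proof -
  have so: "superoperator 2 G" using cp by (simp add: cpso_def)
  obtain b00 b01 b10 b11 where B: "G (mat2 0 1 0 0) = mat2 b00 b01 b10 b11"
    using mat2_eta superoperator_carrier[OF so mat2_carrier] by blast
  note form = choi_form(2)[OF cp A D B]
  \<comment> \<open>The vector (- q, p) is a multiple of f and spans the kernel of e
    e^dagger.\<close>
  have ker0: "p * (cmod (- q))\<^sup>2 + 2 * Re (q * of_real p * cnj (- q)) + (1 - p) * (cmod (of_real p))\<^sup>2 = 0"
  proof -
    have "q * of_real p * cnj (- q) = of_real (- p * (cmod q)\<^sup>2)"
      by (simp only: of_real_mult of_real_minus complex_norm_square) simp
    then show ?thesis
      by (simp only: Re_complex_of_real norm_minus_cancel norm_of_real power2_abs pure)
        (simp add: algebra_simps power2_eq_square)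
  qed
  \<comment> \<open>Likewise (p, cnj q) is a multiple of e and spans the kernel of f
    f^dagger.\<close>
  have ker1: "(1 - p) * (cmod (of_real p))\<^sup>2 + 2 * Re (- q * cnj q * cnj (of_real p))
      + (1 - (1 - p)) * (cmod (cnj q))\<^sup>2 = 0"
  proof -
    have "- q * cnj q * cnj (of_real p) = of_real (- p * (cmod q)\<^sup>2)"
      by (simp only: of_real_mult of_real_minus complex_norm_square) simp
    then show ?thesis
      by (simp only: Re_complex_of_real complex_mod_cnj norm_of_real power2_abs pure)
        (simp add: algebra_simps power2_eq_square)
  qed
  \<comment> \<open>With one half of the vector in a kernel and one entry of the other half free,
    the form becomes a quadratic in that entry without constant term, so its linear coefficient
    vanishes. Three such equations determine G(|0><1|) up to a scalar.\<close>
  have "b00 * cnj (- q) + b10 * cnj (of_real p) = 0"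
    by (rule quadratic_nonneg_imp_linear_zero[of "1 - p"])
      (use form[of "- q" "of_real p" _ 0] in \<open>simp only: ker0, simp\<close>)
  then have e10: "b10 * p = b00 * cnj q" by (simp add: algebra_simps)
  have "b01 * cnj (- q) + b11 * cnj (of_real p) = 0"
    by (rule quadratic_nonneg_imp_linear_zero[of "1 - (1 - p)"])
      (use form[of "- q" "of_real p" 0] in \<open>simp only: ker0, simp\<close>)
  then have e11: "b11 * p = b01 * cnj q" by (simp add: algebra_simps)
  have "b00 * p + b01 * cnj q = 0"
  proof -
    have "cnj (b00 * p + b01 * cnj q) = 0"
    proof (rule quadratic_nonneg_imp_linear_zero[of p])
      fix u :: complex
      have "Re (of_real p * (b00 * cnj u) + cnj q * (b01 * cnj u)) = Re (u * cnj (b00 * p + b01 * cnj q))"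
        by (simp add: algebra_simps)
      then show "0 \<le> p * (cmod u)\<^sup>2 + 2 * Re (u * cnj (b00 * p + b01 * cnj q))"
        using form[of u 0 "of_real p" "cnj q"] unfolding ker1 by simp
    qed
    then show ?thesis by (metis complex_cnj_zero_iff)
  qed
  then have e00: "b00 * p = - (b01 * cnj q)" by (simp add: eq_neg_iff_add_eq_0)
  \<comment> \<open>The upper right entry of e f^dagger is p.\<close>
  define c where "c = b01 / p"
  have b: "b01 = c * p" "b11 = c * cnj q" "b00 = - (c * cnj q)"
    using e11 e00 p by (simp_all add: c_def field_simps)
  then have b': "b10 = - (c * (cnj q)\<^sup>2 / p)"
    using e10 p by (simp add: field_simps power2_eq_square)
  show ?thesis
    by (rule that[of c]) (simp_all add: B choi_form(1)[OF cp A D B] b b')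
qed

section \<open>Conjugation by SU(2) matrices\<close>

definition su2 :: "complex \<Rightarrow> complex \<Rightarrow> complex mat" where
  "su2 a b = mat2 a (- cnj b) b (cnj a)"

lemma unitary_superop_apply:
  "unitary_superop U X = U * X * mat_adjoint U" if "X \<in> carrier_mat 2 2"
  using that by (simp add: unitary_superop_def)

text \<open>Outside the carrier both maps are \<open>undefined\<close>, so agreement on explicit
  matrices is enough.\<close>

lemma superoperator_ext:
  assumes "superoperator 2 G" "superoperator 2 H"
    and "\<And>a b c d. G (mat2 a b c d) = H (mat2 a b c d)"
  shows "G = H"
proof
  fix X
  show "G X = H X"
  proof (cases "X \<in> carrier_mat 2 2")
    case True
    then show ?thesis using mat2_eta assms(3) by metis
  next
    case False
    then show ?thesis using assms(1,2) unfolding superoperator_def by (metis PiE_arb)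
  qed
qed

lemma superoperator_unitary_superop:
  assumes "U \<in> carrier_mat 2 2"
  shows "superoperator 2 (unitary_superop U)"
proof -
  note U = assms
  have adj: "mat_adjoint U \<in> carrier_mat 2 2" by (subst adj2[OF U]) simp
  note UX = mult_carrier_mat[OF U]
  have "unitary_superop U (X + Y) = unitary_superop U X + unitary_superop U Y"
    and "unitary_superop U (x \<cdot>\<^sub>m X) = x \<cdot>\<^sub>m unitary_superop U X"
    if X: "X \<in> carrier_mat 2 2" and Y: "Y \<in> carrier_mat 2 2" for X Y x
    using that mult_smult_distrib[OF U X] mult_smult_assoc_mat[OF UX[OF X] adj]
      mult_add_distrib_mat[OF U X Y] add_mult_distrib_mat[OF UX[OF X] UX[OF Y] adj]
    by (simp_all add: unitary_superop_def)
  moreover have "unitary_superop U \<in> carrier_mat 2 2 \<rightarrow>\<^sub>E carrier_mat 2 2"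
    using mult_carrier_mat[OF UX adj] by (intro PiE_I) (simp_all add: unitary_superop_def)
  ultimately show ?thesis unfolding superoperator_def by blast
qed

text \<open>The phase meets its conjugate in U X U^dagger and cancels. This allows normalising a
  unitary to determinant 1, and changing its sign.\<close>

lemma unitary_superop_phase:
  assumes "u * cnj u = 1"
  shows "unitary_superop (mat2 (u * a) (u * b) (u * c) (u * d)) = unitary_superop (mat2 a b c d)"
proof (rule superoperator_ext)
  fix x y z w
  have "(u * r) * s * (cnj u * t) = (u * cnj u) * (r * s * t)" for r s t by (simp add: ac_simps)
  then have *: "u * r * s * (cnj u * t) = r * s * t" for r s t using assms by simp
  show "unitary_superop (mat2 (u * a) (u * b) (u * c) (u * d)) (mat2 x y z w)
      = unitary_superop (mat2 a b c d) (mat2 x y z w)"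
    by (simp add: unitary_superop_apply mat2_eq_iff distrib_right *)
qed (simp_all add: superoperator_unitary_superop)

text \<open>In the basis e, f the map G multiplies the coherence of its input by c. As 0 < p < 1,
  the input \<open>state p q\<close> has nonzero coherence, so its image can only be pure if |c| =
  1. A square root of c then splits into the phases of the two columns of the unitary.\<close>

lemma cpso_eq_unitary_superop:
  assumes cp: "cpso G"
    and A: "G (mat2 1 0 0 0) = state p q" and D: "G (mat2 0 0 0 1) = state (1 - p) (- q)"
    and pure: "(cmod q)\<^sup>2 = p * (1 - p)" and p: "0 < p" "p < 1"
    and A2: "G (state p q) = state p2 q2" and pure2: "(cmod q2)\<^sup>2 = p2 * (1 - p2)"
  obtains a b where "(cmod a)\<^sup>2 + (cmod b)\<^sup>2 = 1" "G = unitary_superop (su2 a b)"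
proof -
  have so: "superoperator 2 G" using cp by (simp add: cpso_def)
  obtain c where B: "G (mat2 0 1 0 0) = mat2 (- (c * cnj q)) (c * p) (- (c * (cnj q)\<^sup>2 / p)) (c * cnj q)"
    and C: "G (mat2 0 0 1 0) = mat2 (- (cnj c * q)) (- (cnj c * q\<^sup>2 / p)) (cnj c * p) (cnj c * q)"
    using choi_off_diagonal[OF cp A D pure p(1)] .
  have qq: "q * cnj q = of_real (p * (1 - p))"
    using pure complex_norm_square[of q] by simp
  have "cmod c = 1"
  proof -
    have G2: "p2 = of_real p * of_real p + q * (- (c * cnj q)) + cnj q * (- (cnj c * q))
          + (1 - of_real p) * of_real (1 - p)"
      "q2 = of_real p * q + q * (c * p) + cnj q * (- (cnj c * q\<^sup>2 / p)) + (1 - of_real p) * (- q)"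
      using A2 superoperator_mat2[OF so, of "of_real p" q "cnj q" "of_real (1 - p)"]
      unfolding A B C D by (simp_all add: state_def mat2_eq_iff)
    have "complex_of_real p2 = of_real p * of_real p + (1 - of_real p) * of_real (1 - p) - (q * cnj q) * (c + cnj c)"
      unfolding G2 by (simp add: algebra_simps)
    also have "\<dots> = of_real (p * p + (1 - p) * (1 - p) - 2 * (p * (1 - p)) * Re c)"
      unfolding qq complex_add_cnj by simp
    finally have P2: "p2 = p * p + (1 - p) * (1 - p) - 2 * (p * (1 - p)) * Re c"
      by (simp only: of_real_eq_iff)
    have "q2 = q * (of_real (2 * p - 1) + c * p) - (q * cnj q) * q * cnj c / p"
      unfolding G2 by (simp add: algebra_simps power2_eq_square)
    also have "\<dots> = q * (of_real (2 * p - 1) + c * p - cnj c * of_real (1 - p))"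
      unfolding qq using p by (simp add: field_simps)
    finally have "(cmod q2)\<^sup>2 = (cmod q)\<^sup>2 * (cmod (of_real (2 * p - 1) + c * p - cnj c * of_real (1 - p)))\<^sup>2"
      by (simp add: norm_mult power_mult_distrib)
    also have "(cmod (of_real (2 * p - 1) + c * p - cnj c * of_real (1 - p)))\<^sup>2
        = ((2 * p - 1) * (1 + Re c))\<^sup>2 + (Im c)\<^sup>2"
      unfolding cmod_power2 by (simp add: algebra_simps power2_eq_square)
    finally have "p * (1 - p) * (((2 * p - 1) * (1 + Re c))\<^sup>2 + (Im c)\<^sup>2)
        = p2 * (1 - p2)" using pure pure2 by simp
    \<comment> \<open>Since p^2 + (1 - p)^2 = 1 - 2 p (1 - p), \<open>P2\<close> says that 1 - p2 =
      2 p (1 - p) (1 + Re c).\<close>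
    also have "\<dots> = p * (1 - p) * (2 * (1 + Re c) * (1 - 2 * (p * (1 - p)) * (1 + Re c)))"
      unfolding P2 by (simp add: algebra_simps power2_eq_square)
    finally have "((2 * p - 1) * (1 + Re c))\<^sup>2 + (Im c)\<^sup>2
        = 2 * (1 + Re c) * (1 - 2 * (p * (1 - p)) * (1 + Re c))" using p by simp
    \<comment> \<open>As (2 p - 1)^2 = 1 - 4 p (1 - p), the terms with p cancel and (1 + Re c)^2 +
      (Im c)^2 = 2 (1 + Re c) remains.\<close>
    then have "(Re c)\<^sup>2 + (Im c)\<^sup>2 = 1" by (simp add: algebra_simps power2_eq_square)
    then show ?thesis by (simp add: cmod_def)
  qed
  define u where "u = csqrt c"
  have uu: "u * u = c" by (simp add: u_def flip: power2_eq_square)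
  have u1: "cmod u = 1"
    using \<open>cmod c = 1\<close> uu by (metis norm_ge_zero norm_mult power2_eq_1_iff power2_eq_square not_one_le_zero
        neg_0_le_iff_le le_minus_one_simps(3))
  have ucu: "u * cnj u = 1" using complex_norm_square[of u] u1 by simp
  define r where "r = complex_of_real (sqrt p)"
  have rr: "r * r = of_real p" "cnj r = r" "r \<noteq> 0" using p by (auto simp: r_def simp flip: of_real_mult)
  \<comment> \<open>The columns of \<open>su2 a b\<close> become u e and (cnj u) f, so conjugation
    sends |0><1| to u^2 e f^dagger = c e f^dagger.\<close>
  define a b where "a = u * r" and "b = u * (cnj q / r)"
  have ab: "a * cnj a = of_real p" "a * cnj b = q" "b * cnj b = of_real (1 - p)"
    "a * a = c * p" "a * b = c * cnj q" "b * b = c * (cnj q)\<^sup>2 / p"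
  proof -
    have "a * cnj a = (u * cnj u) * (r * r)" by (simp add: a_def rr)
    then show "a * cnj a = of_real p" using ucu rr by simp
    have "a * cnj b = (u * cnj u) * q" using rr by (simp add: a_def b_def)
    then show "a * cnj b = q" using ucu by simp
    have "b * cnj b = (u * cnj u) * (q * cnj q) / (r * r)" by (simp add: b_def rr)
    then show "b * cnj b = of_real (1 - p)" unfolding ucu qq rr using p by simp
    show "a * a = c * p" by (simp add: a_def uu[symmetric] rr(1)[symmetric])
    show "a * b = c * cnj q" using rr by (simp add: a_def b_def uu[symmetric])
    show "b * b = c * (cnj q)\<^sup>2 / p"
      by (simp add: b_def uu[symmetric] rr(1)[symmetric] power2_eq_square)
  qed
  have ab': "cnj a * cnj a = cnj c * p" "cnj a * cnj b = cnj c * q" "cnj b * cnj b = cnj c * q\<^sup>2 / p"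
    "b * cnj a = cnj q"
    using ab(2,4-6)[THEN arg_cong[of _ _ cnj]] by (simp_all add: mult.commute)
  have "complex_of_real ((cmod a)\<^sup>2 + (cmod b)\<^sup>2) = 1"
    unfolding of_real_add complex_norm_square ab by simp
  then have "(cmod a)\<^sup>2 + (cmod b)\<^sup>2 = 1" by (simp only: of_real_eq_1_iff)
  moreover have "G = unitary_superop (su2 a b)"
  proof (rule superoperator_ext)
    show sup: "superoperator 2 (unitary_superop (su2 a b))"
      by (rule superoperator_unitary_superop) (simp add: su2_def)
    have "unitary_superop (su2 a b) (mat2 1 0 0 0) = G (mat2 1 0 0 0)"
      "unitary_superop (su2 a b) (mat2 0 1 0 0) = G (mat2 0 1 0 0)"
      "unitary_superop (su2 a b) (mat2 0 0 1 0) = G (mat2 0 0 1 0)"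
      "unitary_superop (su2 a b) (mat2 0 0 0 1) = G (mat2 0 0 0 1)"
      unfolding A B C D
      by (simp_all add: unitary_superop_apply su2_def state_def mat2_eq_iff ab ab'
          ab[THEN trans[OF mult.commute]] ab'[THEN trans[OF mult.commute]])
    then show "G (mat2 x y z w) = unitary_superop (su2 a b) (mat2 x y z w)" for x y z w
      by (simp only: superoperator_mat2[OF so, of x] superoperator_mat2[OF sup, of x])
  qed (rule so)
  ultimately show ?thesis by (rule that)
qed

section \<open>Rotations\<close>

text \<open>This is (1 + w)/2 I + (1 - w)/2 N, where N is the Pauli matrix along the axis with polar
  angle \<theta> and azimuth \<phi>: eigenvalue 1 on the axis state and w on the opposite one.
  Keeping w complex turns composition into multiplication.\<close>

definition rot_mat :: "complex \<Rightarrow> real \<Rightarrow> real \<Rightarrow> complex mat" where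
  "rot_mat w \<theta> \<phi> = mat2
     ((1 + w) / 2 + of_real (cos \<theta>) * ((1 - w) / 2)) (cnj (cis \<phi>) * of_real (sin \<theta>) * ((1 - w) / 2))
     (cis \<phi> * of_real (sin \<theta>) * ((1 - w) / 2)) ((1 + w) / 2 - of_real (cos \<theta>) * ((1 - w) / 2))"

lemma rot_mat_carrier [simp]: "rot_mat w \<theta> \<phi> \<in> carrier_mat 2 2"
  by (simp add: rot_mat_def)

lemma rot_mat_one: "rot_mat 1 \<theta> \<phi> = 1\<^sub>m 2"
  by (simp add: rot_mat_def one_mat2)

lemma rot_mat_adjoint: "mat_adjoint (rot_mat w \<theta> \<phi>) = rot_mat (cnj w) \<theta> \<phi>"
  by (simp add: rot_mat_def)

text \<open>The two factors have the same eigenvectors, so the eigenvalues multiply.\<close>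

lemma rot_mat_mult: "rot_mat v \<theta> \<phi> * rot_mat w \<theta> \<phi> = rot_mat (v * w) \<theta> \<phi>"
proof -
  define C S x y where "C = complex_of_real (cos \<theta>)" and "S = complex_of_real (sin \<theta>)"
    and "x = cis \<phi>" and "y = cnj (cis \<phi>)"
  have xy: "x * y = 1" "y * x = 1" by (simp_all add: x_def y_def cis_cnj cis_mult)
  have CS: "S * S = 1 - C * C"
    using sin_squared_eq[of \<theta>, THEN arg_cong[of _ _ complex_of_real]]
    by (simp add: C_def S_def power2_eq_square)
  have 1: "((1 + v) / 2 + C * ((1 - v) / 2)) * ((1 + w) / 2 + C * ((1 - w) / 2))
      + y * S * ((1 - v) / 2) * (x * S * ((1 - w) / 2)) = (1 + v * w) / 2 + C * ((1 - v * w) / 2)"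
  proof -
    have "y * S * ((1 - v) / 2) * (x * S * ((1 - w) / 2)) = (y * x) * (S * S) * ((1 - v) * (1 - w) / 4)"
      by simp
    then have T: "y * S * ((1 - v) / 2) * (x * S * ((1 - w) / 2)) = (1 - C * C) * ((1 - v) * (1 - w) / 4)"
      unfolding CS xy by simp
    show ?thesis unfolding T by (simp add: field_simps)
  qed
  have 2: "x * S * ((1 - v) / 2) * (y * S * ((1 - w) / 2))
      + ((1 + v) / 2 - C * ((1 - v) / 2)) * ((1 + w) / 2 - C * ((1 - w) / 2))
      = (1 + v * w) / 2 - C * ((1 - v * w) / 2)"
  proof -
    have "x * S * ((1 - v) / 2) * (y * S * ((1 - w) / 2)) = (x * y) * (S * S) * ((1 - v) * (1 - w) / 4)"
      by simp
    then have T: "x * S * ((1 - v) / 2) * (y * S * ((1 - w) / 2)) = (1 - C * C) * ((1 - v) * (1 - w) / 4)"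
      unfolding CS xy by simp
    show ?thesis unfolding T by (simp add: field_simps)
  qed
  show ?thesis
    unfolding rot_mat_def mat2_mult mat2_eq_iff C_def[symmetric] S_def[symmetric] y_def[symmetric]
    \<comment> \<open>Folded after \<open>y\<close>, whose definition contains
      \<open>cis \<phi>\<close> as a subterm.\<close>
    unfolding x_def[symmetric]
  proof (intro conjI)
    show "((1 + v) / 2 + C * ((1 - v) / 2)) * (y * S * ((1 - w) / 2))
      + y * S * ((1 - v) / 2) * ((1 + w) / 2 - C * ((1 - w) / 2)) = y * S * ((1 - v * w) / 2)"
      "x * S * ((1 - v) / 2) * ((1 + w) / 2 + C * ((1 - w) / 2))
      + ((1 + v) / 2 - C * ((1 - v) / 2)) * (x * S * ((1 - w) / 2)) = x * S * ((1 - v * w) / 2)"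
      by (simp_all add: field_simps)
  qed (fact 1 2)+
qed

lemma mat2_mult_vec:
  "mat2 a b c d *\<^sub>v vec 2 (\<lambda>i. if i = 0 then x else y)
     = vec 2 (\<lambda>i. if i = 0 then a * x + b * y else c * x + d * y)"
  by (intro eq_vecI) (auto simp: scalar_prod_def numeral_2_eq_2 sum.atLeast0_lessThan_Suc less_Suc_eq)

text \<open>Half-angle formulas rewrite the entries in terms of cos (\<theta>/2) and sin
  (\<theta>/2), where the eigenvector equations can be checked; uniqueness of the rotation does the
  rest.\<close>

lemma rotation_eq_rot_mat: "rotation \<alpha> \<theta> \<phi> = rot_mat (cis \<alpha>) \<theta> \<phi>"
proof -
  define w where "w = cis \<alpha>"
  define c s where "c = complex_of_real (cos (\<theta> / 2))" and "s = complex_of_real (sin (\<theta> / 2))"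
  define x y where "x = cis \<phi>" and "y = cnj (cis \<phi>)"
  have xy: "x * y = 1" by (simp add: x_def y_def cis_cnj cis_mult)
  have ww: "w * cnj w = 1" "cnj w * w = 1" by (simp_all add: w_def cis_cnj cis_mult)
  have ss: "s * s = 1 - c * c"
    using sin_squared_eq[of "\<theta> / 2", THEN arg_cong[of _ _ complex_of_real]]
    by (simp add: c_def s_def power2_eq_square)
  have C: "complex_of_real (cos \<theta>) = 2 * (c * c) - 1"
    using cos_double_cos[of "\<theta> / 2"] by (simp add: c_def power2_eq_square)
  have S: "complex_of_real (sin \<theta>) = 2 * (s * c)"
    using sin_double[of "\<theta> / 2"] by (simp add: c_def s_def)
  have psi: "psi \<theta> \<phi> = vec 2 (\<lambda>i. if i = 0 then c else x * s)"
    and perp: "psi_perp \<theta> \<phi> = vec 2 (\<lambda>i. if i = 0 then s else - (x * c))"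
    by (auto simp: psi_def psi_perp_def c_def s_def x_def less_2_cases_iff)
  have R: "rot_mat w \<theta> \<phi> = mat2 (c * c + w * (s * s)) (y * (s * c) * (1 - w))
      (x * (s * c) * (1 - w)) (s * s + w * (c * c))"
    unfolding rot_mat_def C S ss y_def[symmetric] unfolding x_def[symmetric]
    by (simp add: mat2_eq_iff field_simps)
  have "is_rotation \<alpha> \<theta> \<phi> (rot_mat w \<theta> \<phi>)"
    unfolding is_rotation_def unitary_mat_def rot_mat_adjoint rot_mat_mult ww rot_mat_one
      w_def[symmetric]
  proof (intro conjI)
    have "(c * c + w * (s * s)) * c + y * (s * c) * (1 - w) * (x * s)
        = (c * c + w * (s * s)) * c + (x * y) * (s * s) * c * (1 - w)"
      by simp
    also have "\<dots> = c" unfolding xy ss by (simp add: algebra_simps)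
    finally have e1: "(c * c + w * (s * s)) * c + y * (s * c) * (1 - w) * (x * s) = c" .
    have "x * (s * c) * (1 - w) * c + (s * s + w * (c * c)) * (x * s) = x * s * (s * s + c * c)"
      by (simp add: algebra_simps)
    then have e2: "x * (s * c) * (1 - w) * c + (s * s + w * (c * c)) * (x * s) = x * s"
      unfolding ss by simp
    show "rot_mat w \<theta> \<phi> *\<^sub>v psi \<theta> \<phi> = psi \<theta> \<phi>"
      unfolding R psi mat2_mult_vec e1 e2 ..
    have "(c * c + w * (s * s)) * s + y * (s * c) * (1 - w) * - (x * c)
        = (c * c + w * (s * s)) * s - (x * y) * (c * c) * s * (1 - w)"
      by simp
    also have "\<dots> = w * s * (s * s + c * c)" unfolding xy by (simp add: algebra_simps)
    finally have e3: "(c * c + w * (s * s)) * s + y * (s * c) * (1 - w) * - (x * c) = w * s"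
      unfolding ss by simp
    have "x * (s * c) * (1 - w) * s + (s * s + w * (c * c)) * - (x * c)
        = - (w * (x * c)) * (s * s + c * c)"
      by (simp add: algebra_simps)
    then have e4: "x * (s * c) * (1 - w) * s + (s * s + w * (c * c)) * - (x * c) = w * - (x * c)"
      unfolding ss by simp
    show "rot_mat w \<theta> \<phi> *\<^sub>v psi_perp \<theta> \<phi> = w \<cdot>\<^sub>v psi_perp \<theta> \<phi>"
      unfolding R perp mat2_mult_vec e3 e4 by (intro eq_vecI) auto
  qed simp_all
  then show ?thesis unfolding rotation_def w_def using ex1_rotation by (metis the1_equality)
qed

lemma funpow_rot_mat:
  assumes X: "X \<in> carrier_mat 2 2"
  shows "(unitary_superop (rot_mat w \<theta> \<phi>) ^^ k) X = rot_mat (w ^ k) \<theta> \<phi> * X * rot_mat (cnj w ^ k) \<theta> \<phi>"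
proof (induction k)
  case 0
  then show ?case using X by (simp add: rot_mat_one)
next
  case (Suc k)
  let ?R = "\<lambda>w. rot_mat w \<theta> \<phi>"
  have RX: "?R (w ^ k) * X \<in> carrier_mat 2 2"
    by (rule mult_carrier_mat[OF rot_mat_carrier X])
  have RXR: "?R (w ^ k) * X * ?R (cnj w ^ k) \<in> carrier_mat 2 2"
    by (rule mult_carrier_mat[OF RX rot_mat_carrier])
  then have "(unitary_superop (?R w) ^^ Suc k) X = ?R w * (?R (w ^ k) * X * ?R (cnj w ^ k)) * ?R (cnj w)"
    by (simp add: Suc unitary_superop_apply rot_mat_adjoint)
  moreover have "?R w * (?R (w ^ k) * X * ?R (cnj w ^ k)) = (?R w * ?R (w ^ k)) * X * ?R (cnj w ^ k)"
    by (simp only: assoc_mult_mat[OF rot_mat_carrier RX rot_mat_carrier, symmetric]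
        assoc_mult_mat[OF rot_mat_carrier rot_mat_carrier X, symmetric])
  moreover have "?R w * ?R (w ^ k) * X * ?R (cnj w ^ k) * ?R (cnj w)
      = ?R w * ?R (w ^ k) * X * (?R (cnj w ^ k) * ?R (cnj w))"
    by (rule assoc_mult_mat[OF mult_carrier_mat[OF mult_carrier_mat[OF rot_mat_carrier rot_mat_carrier] X]
          rot_mat_carrier rot_mat_carrier])
  ultimately show ?case by (simp add: rot_mat_mult power_commutes)
qed

text \<open>The complex number is the amplitude from |0> to |0> under rotation by \<beta>; its
  squared modulus is the origin of \<open>z_coeff\<close>.\<close>

lemma cmod_rot_mat_entry:
  "(cmod ((1 + cis \<beta>) / 2 + of_real (cos \<theta>) * ((1 - cis \<beta>) / 2)))\<^sup>2
     = 1 / 2 + 1 / 2 * ((cos \<theta>)\<^sup>2 + (sin \<theta>)\<^sup>2 * cos \<beta>)"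
proof -
  have *: "(sin \<beta>)\<^sup>2 = 1 - (cos \<beta>)\<^sup>2" "(sin \<theta>)\<^sup>2 = 1 - (cos \<theta>)\<^sup>2" by (rule sin_squared_eq)+
  have "(cmod ((1 + cis \<beta>) / 2 + of_real (cos \<theta>) * ((1 - cis \<beta>) / 2)))\<^sup>2
      = (((1 + cos \<beta>) + cos \<theta> * (1 - cos \<beta>)) / 2)\<^sup>2 + (1 - cos \<theta>)\<^sup>2 * (sin \<beta>)\<^sup>2 / 4"
    unfolding cmod_power2 by (simp add: field_simps power2_eq_square)
  also have "\<dots> = 1 / 2 + 1 / 2 * ((cos \<theta>)\<^sup>2 + (sin \<theta>)\<^sup>2 * cos \<beta>)"
    unfolding * by (simp add: field_simps power2_eq_square)
  finally show ?thesis .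
qed

lemma Pr0_funpow_rotation:
  "Pr0 ((unitary_superop (rotation \<alpha> \<theta> \<phi>) ^^ k) (proj ket0))
     = of_real (1 / 2 + 1 / 2 * z_coeff k \<alpha> \<theta>)"
proof -
  let ?e = "(1 + cis (real k * \<alpha>)) / 2 + of_real (cos \<theta>) * ((1 - cis (real k * \<alpha>)) / 2)"
  have "Pr0 ((unitary_superop (rotation \<alpha> \<theta> \<phi>) ^^ k) (proj ket0)) = ?e * cnj ?e"
    unfolding rotation_eq_rot_mat proj_ket0 funpow_rot_mat[OF mat2_carrier]
    by (simp add: rot_mat_def Complex.DeMoivre flip: complex_cnj_power)
  also have "\<dots> = of_real ((cmod ?e)\<^sup>2)" by (simp only: complex_norm_square)
  finally show ?thesis unfolding cmod_rot_mat_entry z_coeff_def .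
qed

lemma Pr0_funpow_rotation_period:
  assumes "cis \<alpha> ^ k = 1"
  shows "Pr0 ((unitary_superop (rotation \<alpha> \<theta> \<phi>) ^^ k) (proj ket1)) = 0"
proof -
  have "cnj (cis \<alpha>) ^ k = 1" using assms by (simp flip: complex_cnj_power)
  then show ?thesis
    unfolding rotation_eq_rot_mat proj_ket1 funpow_rot_mat[OF mat2_carrier] assms
    by (simp add: rot_mat_def)
qed

text \<open>The determinant of \<open>rot_mat w \<theta> \<phi>\<close> is w, so dividing by the
  square root u gives determinant 1. Hence \<beta> is half the rotation angle.\<close>

lemma rot_mat_eq_su2:
  assumes w: "w = u * u" and u: "u = cis \<beta>"
  shows "unitary_superop (rot_mat w \<theta> \<phi>) = unitary_superop (su2
    (of_real (cos \<beta>) - \<i> * of_real (sin \<beta> * cos \<theta>)) (- \<i> * of_real (sin \<beta> * sin \<theta>) * cis \<phi>))"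
proof -
  have uu: "u * cnj u = 1" by (simp add: u cis_cnj cis_mult)
  have c: "(1 + w) / 2 = u * of_real (cos \<beta>)" and s: "(1 - w) / 2 = u * (- \<i> * of_real (sin \<beta>))"
  proof -
    have "1 + w = u * (cnj u + u)" "1 - w = u * (cnj u - u)"
      using uu by (simp_all add: w algebra_simps)
    moreover have "cnj u + u = 2 * of_real (cos \<beta>)" "cnj u - u = 2 * (- \<i> * of_real (sin \<beta>))"
      by (simp_all add: u complex_eq_iff)
    ultimately show "(1 + w) / 2 = u * of_real (cos \<beta>)" "(1 - w) / 2 = u * (- \<i> * of_real (sin \<beta>))"
      by simp_all
  qed
  have "rot_mat w \<theta> \<phi> = mat2
      (u * (of_real (cos \<beta>) - \<i> * of_real (sin \<beta> * cos \<theta>)))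
      (u * (- cnj (- \<i> * of_real (sin \<beta> * sin \<theta>) * cis \<phi>)))
      (u * (- \<i> * of_real (sin \<beta> * sin \<theta>) * cis \<phi>))
      (u * cnj (of_real (cos \<beta>) - \<i> * of_real (sin \<beta> * cos \<theta>)))"
    unfolding rot_mat_def c s by (simp add: mat2_eq_iff algebra_simps)
  then show ?thesis by (simp only: su2_def unitary_superop_phase[OF uu])
qed

lemma unitary_superop_rotation:
  "unitary_superop (rotation \<alpha> \<theta> \<phi>) = unitary_superop (su2
    (of_real (cos (\<alpha> / 2)) - \<i> * of_real (sin (\<alpha> / 2) * cos \<theta>))
    (- \<i> * of_real (sin (\<alpha> / 2) * sin \<theta>) * cis \<phi>))"
  unfolding rotation_eq_rot_mat
  by (rule rot_mat_eq_su2[OF _ refl]) (simp add: cis_mult)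

text \<open>Supplies the azimuth of the axis, in the range used by \<open>rotation_family\<close>.
  Negative r is allowed because the two signs of the rotation angle need opposite signs
  here.\<close>

lemma polar_form_imaginary:
  assumes "(cmod b)\<^sup>2 = r\<^sup>2" "r \<noteq> 0"
  obtains \<phi> where "\<phi> \<in> {0..<2 * pi}" "b = \<i> * of_real r * cis \<phi>"
proof -
  define z where "z = b / (\<i> * of_real r)"
  have "(cmod z)\<^sup>2 = 1" using assms by (simp add: z_def norm_divide norm_mult power_divide)
  then have "(Re z)\<^sup>2 + (Im z)\<^sup>2 = 1" by (simp add: cmod_power2)
  then obtain t where "0 \<le> t" "t < 2 * pi" "Re z = cos t" "Im z = sin t"
    by (rule sincos_total_2pi)
  then have "z = cis t" by (simp add: complex_eq_iff)
  with \<open>0 \<le> t\<close> \<open>t < 2 * pi\<close> show ?thesis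
    using assms by (intro that[of t]) (auto simp: z_def field_simps)
qed

text \<open>The sign of Im a decides between \<alpha> and - \<alpha>, and the phase of b gives
  \<phi>.\<close>

lemma su2_in_rotation_family_if_entries:
  assumes sin: "sin (\<alpha> / 2) \<noteq> 0" "sin \<theta> \<noteq> 0"
    and a: "Re a = cos (\<alpha> / 2)" "(Im a)\<^sup>2 = (sin (\<alpha> / 2) * cos \<theta>)\<^sup>2"
    and b: "(cmod b)\<^sup>2 = (sin (\<alpha> / 2) * sin \<theta>)\<^sup>2"
  shows "unitary_superop (su2 a b) \<in> rotation_family \<alpha> \<theta>"
proof -
  let ?r = "sin (\<alpha> / 2) * sin \<theta>"
  have "Im a = - (sin (\<alpha> / 2) * cos \<theta>) \<or> Im a = sin (\<alpha> / 2) * cos \<theta>"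
    using a(2) by (auto simp: power2_eq_iff)
  then show ?thesis
  proof
    assume "Im a = - (sin (\<alpha> / 2) * cos \<theta>)"
    then have a': "a = of_real (cos (\<alpha> / 2)) - \<i> * of_real (sin (\<alpha> / 2) * cos \<theta>)"
      using a(1) by (simp add: complex_eq_iff)
    obtain \<phi> where "\<phi> \<in> {0..<2 * pi}" "b = \<i> * of_real (- ?r) * cis \<phi>"
      by (rule polar_form_imaginary[of b "- ?r"]) (use b sin in auto)
    then have "\<phi> \<in> {0..<2 * pi}" "unitary_superop (su2 a b) = unitary_superop (rotation \<alpha> \<theta> \<phi>)"
      unfolding unitary_superop_rotation a' by simp_all
    then show ?thesis unfolding rotation_family_def by blast
  next
    assume "Im a = sin (\<alpha> / 2) * cos \<theta>"
    then have a': "a = of_real (cos (- \<alpha> / 2)) - \<i> * of_real (sin (- \<alpha> / 2) * cos \<theta>)"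
      using a(1) by (simp add: complex_eq_iff)
    obtain \<phi> where "\<phi> \<in> {0..<2 * pi}" "b = \<i> * of_real ?r * cis \<phi>"
      by (rule polar_form_imaginary[of b ?r]) (use b sin in auto)
    then have "\<phi> \<in> {0..<2 * pi}" "unitary_superop (su2 a b) = unitary_superop (rotation (- \<alpha>) \<theta> \<phi>)"
      unfolding unitary_superop_rotation a' by simp_all
    then show ?thesis unfolding rotation_family_def by blast
  qed
qed

text \<open>The equation for k = 1 fixes |b|. The one for k = 2 fixes 4 (Re a)^2 |b|^2, hence (Re
  a)^2 because b is nonzero, and normalisation then fixes (Im a)^2.\<close>

lemma su2_in_rotation_family:
  assumes sin: "sin (\<alpha> / 2) \<noteq> 0" "sin \<theta> \<noteq> 0"
    and ab: "(cmod a)\<^sup>2 + (cmod b)\<^sup>2 = 1"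
    and z1: "(cmod a)\<^sup>2 = 1 / 2 + 1 / 2 * z_coeff 1 \<alpha> \<theta>"
    and z2: "(cmod (a * a - b * cnj b))\<^sup>2 = 1 / 2 + 1 / 2 * z_coeff 2 \<alpha> \<theta>"
  shows "unitary_superop (su2 a b) \<in> rotation_family \<alpha> \<theta>"
proof -
  define c s where "c = cos (\<alpha> / 2)" and "s = sin (\<alpha> / 2)"
  define C S where "C = cos \<theta>" and "S = sin \<theta>"
  have s2: "s\<^sup>2 = 1 - c\<^sup>2" and S2: "S\<^sup>2 = 1 - C\<^sup>2"
    unfolding s_def S_def c_def C_def by (rule sin_squared_eq)+
  have cosa: "cos \<alpha> = 2 * c\<^sup>2 - 1" using cos_double_cos[of "\<alpha> / 2"] by (simp add: c_def)
  have cos2a: "cos (2 * \<alpha>) = 2 * (2 * c\<^sup>2 - 1)\<^sup>2 - 1" unfolding cos_double_cos cosa ..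
  have b: "(cmod b)\<^sup>2 = (s * S)\<^sup>2"
    using ab z1 unfolding z_coeff_def by (simp add: cosa power_mult_distrib s2 S2 flip: C_def S_def)
      (simp add: field_simps)
  have bb: "b * cnj b = of_real ((cmod b)\<^sup>2)" by (simp only: complex_norm_square)
  have a: "(Re a)\<^sup>2 + (Im a)\<^sup>2 = 1 - (cmod b)\<^sup>2" using ab by (simp add: cmod_power2)
  have "(cmod (a * a - b * cnj b))\<^sup>2 = ((Re a)\<^sup>2 - (Im a)\<^sup>2 - (cmod b)\<^sup>2)\<^sup>2 + 4 * (Re a)\<^sup>2 * (Im a)\<^sup>2"
    unfolding bb cmod_power2[of "a * a - _"] by (simp add: power2_eq_square algebra_simps)
  also have "(Im a)\<^sup>2 = 1 - (cmod b)\<^sup>2 - (Re a)\<^sup>2" using a by simp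
  also have "((Re a)\<^sup>2 - (1 - (cmod b)\<^sup>2 - (Re a)\<^sup>2) - (cmod b)\<^sup>2)\<^sup>2
      + 4 * (Re a)\<^sup>2 * (1 - (cmod b)\<^sup>2 - (Re a)\<^sup>2) = 1 - 4 * (Re a)\<^sup>2 * (cmod b)\<^sup>2"
    by (simp add: power2_eq_square algebra_simps)
  finally have "1 - 4 * (Re a)\<^sup>2 * (s * S)\<^sup>2 = 1 / 2 + 1 / 2 * z_coeff 2 \<alpha> \<theta>"
    unfolding z2 b by simp
  also have "\<dots> = 1 - 4 * c\<^sup>2 * (s * S)\<^sup>2"
    unfolding z_coeff_def C_def[symmetric] S_def[symmetric] of_nat_numeral cos2a power_mult_distrib s2 S2
    by (simp add: power2_eq_square algebra_simps)
  finally have re: "(Re a)\<^sup>2 = c\<^sup>2" using sin by (simp add: s_def S_def)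
  have im: "(Im a)\<^sup>2 = (s * C)\<^sup>2"
    using a unfolding re b power_mult_distrib s2 S2 by (simp add: algebra_simps)
  consider "Re a = c" | "Re a = - c" using re by (auto simp: power2_eq_iff)
  then show ?thesis
  proof cases
    case 1
    show ?thesis
      by (rule su2_in_rotation_family_if_entries) (use sin 1 im b in \<open>simp_all add: c_def s_def C_def S_def\<close>)
  next
    case 2
    \<comment> \<open>Both a matrix and its negative induce G, so the sign of Re a may be
      flipped.\<close>
    have "unitary_superop (su2 (- a) (- b)) \<in> rotation_family \<alpha> \<theta>"
      by (rule su2_in_rotation_family_if_entries) (use sin 2 im b in \<open>simp_all add: c_def s_def C_def S_def\<close>)
    moreover have "unitary_superop (su2 (- a) (- b)) = unitary_superop (su2 a b)"
      using unitary_superop_phase[of "-1" a "- cnj b" b "cnj a"] by (simp add: su2_def)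
    ultimately show ?thesis by simp
  qed
qed

section \<open>The characterization\<close>

text \<open>Rationality of \<alpha>/\<pi> makes the set under \<open>LEAST\<close> nonempty, and n =
  1 is excluded by 0 < \<alpha> < 2 \<pi>. The bound makes the equation for k = 2 available.\<close>

lemma n_alpha:
  assumes "0 < \<alpha>" "\<alpha> \<le> pi" "\<alpha> / pi \<in> \<rat>"
  shows "n_alpha \<alpha> \<ge> 2" "[real (n_alpha \<alpha>) * \<alpha> = 0] (rmod (2 * pi))"
proof -
  obtain i :: int and j :: nat where j: "j \<noteq> 0" and ij: "\<alpha> / pi = of_int i / of_nat j"
    using assms(3) unfolding Rats_eq_int_div_nat by blast
  have "real (2 * j) * \<alpha> = of_int i * (2 * pi)"
    using ij j by (simp add: field_simps)
  then have "[real (2 * j) * \<alpha> = 0] (rmod (2 * pi))"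
    using rcong_mult_of_int_0_left_left rcong_sym by metis
  with j have "\<exists>n. 0 < n \<and> [real n * \<alpha> = 0] (rmod (2 * pi))"
    by (intro exI[of _ "2 * j"]) simp
  then have n: "0 < n_alpha \<alpha> \<and> [real (n_alpha \<alpha>) * \<alpha> = 0] (rmod (2 * pi))"
    unfolding n_alpha_def by (rule LeastI_ex)
  have "n_alpha \<alpha> \<noteq> 1"
  proof
    assume "n_alpha \<alpha> = 1"
    with n have "\<alpha> rmod (2 * pi) = 0" by (simp add: rcong_def)
    moreover have "\<alpha> rmod (2 * pi) = \<alpha>"
      using assms pi_gt_zero by (intro rmod_idem) (simp del: pi_gt_zero)
    ultimately show False using assms by simp
  qed
  with n show "n_alpha \<alpha> \<ge> 2" "[real (n_alpha \<alpha>) * \<alpha> = 0] (rmod (2 * pi))"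
    by linarith+
qed

text \<open>Tensoring with a one-dimensional space changes nothing, so this is the case M = 1 of
  complete positivity.\<close>

lemma cpso_density:
  assumes "cpso G" "density_matrix 2 \<rho>"
  shows "density_matrix 2 (G \<rho>)"
proof -
  have so: "superoperator 2 G" using assms(1) by (simp add: cpso_def)
  have "pso (2 * 1) (tensor_id 1 G)"
    using assms(1) unfolding cpso_def by (auto simp only: zero_less_one)
  then have dens: "density_matrix 2 (tensor_id 1 G \<rho>)"
    using assms(2) by (simp add: pso_def)
  have \<rho>: "\<rho> \<in> carrier_mat 2 2" using assms(2) by (simp add: density_matrix_def)
  have "tensor_block (Suc 0) \<rho> 0 0 = \<rho>"
    using \<rho> by (intro eq_matI) (auto simp: tensor_block_def)
  then have "tensor_id 1 G \<rho> = G \<rho>"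
    using \<rho> superoperator_carrier[OF so \<rho>] by (intro eq_matI) (auto simp: tensor_id_def)
  with dens show ?thesis by simp
qed

lemma cpso_funpow_density:
  assumes "cpso G" "density_matrix 2 \<rho>"
  shows "density_matrix 2 ((G ^^ k) \<rho>)"
  by (induction k) (simp_all add: assms cpso_density)

lemma superoperator_funpow:
  assumes so: "superoperator 2 G" and X: "X \<in> carrier_mat 2 2" and Y: "Y \<in> carrier_mat 2 2"
  shows "(G ^^ k) X \<in> carrier_mat 2 2"
    and "(G ^^ k) (a \<cdot>\<^sub>m X + b \<cdot>\<^sub>m Y) = a \<cdot>\<^sub>m (G ^^ k) X + b \<cdot>\<^sub>m (G ^^ k) Y"
proof -
  have car: "(G ^^ k) X \<in> carrier_mat 2 2" if "X \<in> carrier_mat 2 2" for k X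
    by (induction k) (simp_all add: that superoperator_carrier[OF so])
  then show "(G ^^ k) X \<in> carrier_mat 2 2" using X .
  show "(G ^^ k) (a \<cdot>\<^sub>m X + b \<cdot>\<^sub>m Y) = a \<cdot>\<^sub>m (G ^^ k) X + b \<cdot>\<^sub>m (G ^^ k) Y"
    by (induction k)
      (simp_all add: superoperator_add[OF so] superoperator_smult[OF so] car[OF X] car[OF Y])
qed

lemma density_matrix_ket0: "density_matrix 2 (proj ket0)"
  and density_matrix_ket1: "density_matrix 2 (proj ket1)"
  using density_matrix_state[of 0 1] density_matrix_state[of 0 0]
  unfolding proj_ket0 proj_ket1 by (simp_all add: state_def)

text \<open>Applying G another k times and then measuring |0> is affine in the coordinates of the
  state and a probability on the Bloch ball.\<close>

lemma funpow_distinguishable_imp_antipodal: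
  assumes cp: "cpso G"
    and state: "(cmod q)\<^sup>2 \<le> p * (1 - p)" "(cmod q')\<^sup>2 \<le> p' * (1 - p')"
    and "Pr0 ((G ^^ k) (state p q)) = 1" "Pr0 ((G ^^ k) (state p' q')) = 0"
  shows "(cmod q)\<^sup>2 = p * (1 - p)" "p' = 1 - p" "q' = - q"
proof -
  have so: "superoperator 2 G" using cp by (simp add: cpso_def)
  let ?h = "\<lambda>p q. Re (Pr0 ((G ^^ k) (state p q)))"
  have st: "state p q \<in> carrier_mat 2 2" for p q by (simp add: state_def)
  have affine: "?h ((1 - t) * p + t * p') (of_real (1 - t) * q + of_real t * q')
      = (1 - t) * ?h p q + t * ?h p' q'" for t p q p' q'
  proof -
    have comb: "state ((1 - t) * p + t * p') (of_real (1 - t) * q + of_real t * q')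
        = of_real (1 - t) \<cdot>\<^sub>m state p q + of_real t \<cdot>\<^sub>m state p' q'"
      by (simp add: state_def mat2_eq_iff algebra_simps)
    obtain x y z w x' y' z' w' where
      "(G ^^ k) (state p q) = mat2 x y z w" "(G ^^ k) (state p' q') = mat2 x' y' z' w'"
      using mat2_eta superoperator_funpow(1)[OF so st st] by metis
    then show ?thesis unfolding comb superoperator_funpow(2)[OF so st st] by simp
  qed
  have bound: "0 \<le> ?h p q \<and> ?h p q \<le> 1" if pq: "(cmod q)\<^sup>2 \<le> p * (1 - p)" for p q
  proof -
    obtain p1 q1 where 1: "(G ^^ k) (state p q) = state p1 q1" "(cmod q1)\<^sup>2 \<le> p1 * (1 - p1)"
      using cpso_funpow_density[OF cp density_matrix_state[OF pq]] by (rule density_matrixD)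
    have "0 \<le> p1 * (1 - p1)" using 1(2) zero_le_power2 order_trans by blast
    then show ?thesis unfolding 1(1) by (auto simp: state_def zero_le_mult_iff)
  qed
  show "(cmod q)\<^sup>2 = p * (1 - p)" "p' = 1 - p" "q' = - q"
    using distinguishable_imp_antipodal[of ?h, OF affine bound state] assms(4,5) by simp_all
qed

lemma rotation_family_of_equations:
  assumes \<alpha>: "0 < \<alpha>" "\<alpha> \<le> pi" and \<theta>: "0 < \<theta>" "\<theta> \<le> pi / 2" and ne: "(\<alpha>, \<theta>) \<noteq> (pi, pi / 2)"
    and n: "n \<ge> 2" "[real n * \<alpha> = 0] (rmod (2 * pi))" and cp: "cpso G"
    and eq1: "Pr0 ((G ^^ n) (proj ket1)) = 0"
    and eq0: "\<And>k. k \<in> {1..n} \<Longrightarrow>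
      Pr0 ((G ^^ k) (proj ket0)) = complex_of_real (1 / 2 + 1 / 2 * z_coeff k \<alpha> \<theta>)"
  shows "G \<in> rotation_family \<alpha> \<theta>"
proof -
  have sin: "sin (\<alpha> / 2) > 0" "sin \<theta> > 0"
    using \<alpha> \<theta> pi_gt_zero by (auto intro!: sin_gt_zero simp del: pi_gt_zero)
  have "cos (real n * \<alpha>) = 1"
    using n(2) cis_eq_iff[of "real n * \<alpha>" 0] by (simp add: complex_eq_iff)
  then have "z_coeff n \<alpha> \<theta> = 1" by (simp add: z_coeff_def)
  then have eqn: "Pr0 ((G ^^ n) (proj ket0)) = 1" using eq0[of n] n(1) by simp
  have pow1: "(G ^^ (n - 1)) (G X) = (G ^^ n) X" for X
    using n(1) funpow_swap1[of G "n - 1" X] by (cases n) (simp_all add: funpow_swap1)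
  \<comment> \<open>For n = 2 no application of G remains, and the distinguishing measurement is
    \<open>Pr0\<close> itself.\<close>
  have pow2: "(G ^^ (n - 2)) (G (G X)) = (G ^^ n) X" for X
    using n(1) by (cases n; cases "n - 1") (simp_all add: funpow_swap1)
  obtain p q where A: "G (proj ket0) = state p q" and pq: "(cmod q)\<^sup>2 \<le> p * (1 - p)"
    using cpso_density[OF cp density_matrix_ket0] by (rule density_matrixD)
  obtain p' q' where D: "G (proj ket1) = state p' q'" and pq': "(cmod q')\<^sup>2 \<le> p' * (1 - p')"
    using cpso_density[OF cp density_matrix_ket1] by (rule density_matrixD)
  obtain p2 q2 where A2: "G (G (proj ket0)) = state p2 q2" and pq2: "(cmod q2)\<^sup>2 \<le> p2 * (1 - p2)"
    using cpso_density[OF cp cpso_density[OF cp density_matrix_ket0]] by (rule density_matrixD)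
  obtain p2' q2' where D2: "G (G (proj ket1)) = state p2' q2'" and pq2': "(cmod q2')\<^sup>2 \<le> p2' * (1 - p2')"
    using cpso_density[OF cp cpso_density[OF cp density_matrix_ket1]] by (rule density_matrixD)
  have pure: "(cmod q)\<^sup>2 = p * (1 - p)" "p' = 1 - p" "q' = - q"
    using funpow_distinguishable_imp_antipodal[OF cp pq pq', of "n - 1"]
    unfolding A[symmetric] D[symmetric] pow1 eqn eq1 by blast+
  have pure2: "(cmod q2)\<^sup>2 = p2 * (1 - p2)"
    using funpow_distinguishable_imp_antipodal(1)[OF cp pq2 pq2', of "n - 2"]
    unfolding A2[symmetric] D2[symmetric] pow2 eqn eq1 by blast
  have "complex_of_real p = of_real (1 / 2 + 1 / 2 * z_coeff 1 \<alpha> \<theta>)"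
    using eq0[of 1] n(1) by (simp add: A) (simp add: state_def)
  then have p: "p = 1 / 2 + 1 / 2 * z_coeff 1 \<alpha> \<theta>" by (simp only: of_real_eq_iff)
  have two: "(G ^^ 2) X = G (G X)" for X by (simp add: numeral_2_eq_2)
  have "complex_of_real p2 = of_real (1 / 2 + 1 / 2 * z_coeff 2 \<alpha> \<theta>)"
    using eq0[of 2] n(1) unfolding two A2 by (simp add: state_def)
  then have p2: "p2 = 1 / 2 + 1 / 2 * z_coeff 2 \<alpha> \<theta>" by (simp only: of_real_eq_iff)
  \<comment> \<open>This product yields p < 1 at once; p = 0 would need both sines equal to 1, which
    is the excluded pair of angles.\<close>
  have 1: "1 - p = (sin \<theta> * sin (\<alpha> / 2))\<^sup>2"
  proof -
    have c: "cos \<alpha> = 1 - 2 * (sin (\<alpha> / 2))\<^sup>2" using cos_double_sin[of "\<alpha> / 2"] by simp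
    show ?thesis
      unfolding p z_coeff_def power_mult_distrib cos_squared_eq of_nat_1 mult_1_left c
      by (simp add: field_simps)
  qed
  moreover have "0 < (sin \<theta> * sin (\<alpha> / 2))\<^sup>2" using sin by simp
  ultimately have "p < 1" by linarith
  have "p > 0"
  proof (rule ccontr)
    assume "\<not> p > 0"
    then have "1 \<le> (sin \<theta>)\<^sup>2 * (sin (\<alpha> / 2))\<^sup>2" using 1 by (simp add: power_mult_distrib)
    moreover have "(sin \<theta>)\<^sup>2 * (sin (\<alpha> / 2))\<^sup>2 \<le> 1 * (sin (\<alpha> / 2))\<^sup>2"
      "(sin \<theta>)\<^sup>2 * (sin (\<alpha> / 2))\<^sup>2 \<le> (sin \<theta>)\<^sup>2 * 1"
      by (rule mult_right_mono mult_left_mono; simp add: abs_square_le_1)+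
    ultimately have "(cos \<theta>)\<^sup>2 \<le> 0" "(cos (\<alpha> / 2))\<^sup>2 \<le> 0" by (simp_all add: cos_squared_eq)
    then have "cos \<theta> = 0" "cos (\<alpha> / 2) = 0" by simp_all
    then have "\<theta> = pi / 2" "\<alpha> / 2 = pi / 2"
      using \<alpha> \<theta> cos_gt_zero[of \<theta>] cos_gt_zero[of "\<alpha> / 2"] by linarith+
    then show False using ne by simp
  qed
  obtain a b where ab: "(cmod a)\<^sup>2 + (cmod b)\<^sup>2 = 1" and G: "G = unitary_superop (su2 a b)"
    by (rule cpso_eq_unitary_superop[OF cp _ _ pure(1) \<open>0 < p\<close> \<open>p < 1\<close> _ pure2])
      (use A D A2 pure in \<open>simp_all only: proj_ket0 proj_ket1\<close>)
  have G0: "G (mat2 1 0 0 0) = mat2 (a * cnj a) (a * cnj b) (b * cnj a) (b * cnj b)"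
    by (simp add: G unitary_superop_apply su2_def)
  have "complex_of_real p = a * cnj a" using A by (simp add: G0 proj_ket0 state_def mat2_eq_iff)
  then have z1: "(cmod a)\<^sup>2 = p" by (simp only: complex_norm_square[symmetric] of_real_eq_iff)
  have "complex_of_real p2 = Pr0 (G (G (mat2 1 0 0 0)))" using A2 by (simp add: proj_ket0 state_def)
  \<comment> \<open>The first factor is the upper left entry of the square of
    \<open>su2 a b\<close>.\<close>
  also have "\<dots> = (a * a - b * cnj b) * cnj (a * a - b * cnj b)"
    unfolding G0 by (simp add: G unitary_superop_apply su2_def algebra_simps)
  finally have z2: "(cmod (a * a - b * cnj b))\<^sup>2 = p2"
    by (simp only: complex_norm_square[symmetric] of_real_eq_iff)
  show ?thesis
    unfolding G by (rule su2_in_rotation_family) (use sin ab z1 z2 p p2 in auto)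
qed

text \<open>Replacing \<alpha> by - \<alpha> conjugates the eigenvalue and leaves the cosine in
  \<open>z_coeff\<close> unchanged, so both signs satisfy the same equations.\<close>

lemma equations_of_rotation_family:
  assumes n: "[real n * \<alpha> = 0] (rmod (2 * pi))" and G: "G \<in> rotation_family \<alpha> \<theta>"
  shows "Pr0 ((G ^^ n) (proj ket1)) = 0"
    and "Pr0 ((G ^^ k) (proj ket0)) = complex_of_real (1 / 2 + 1 / 2 * z_coeff k \<alpha> \<theta>)"
proof -
  obtain \<beta> \<phi> where \<beta>: "\<beta> = \<alpha> \<or> \<beta> = - \<alpha>" and G': "G = unitary_superop (rotation \<beta> \<theta> \<phi>)"
    using G unfolding rotation_family_def by blast
  have "cis \<alpha> ^ n = 1" using n cis_eq_iff[of "real n * \<alpha>" 0] by (simp add: Complex.DeMoivre)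
  moreover have "cis (- \<alpha>) ^ n = cnj (cis \<alpha> ^ n)" by (simp add: cis_cnj)
  ultimately have "cis \<beta> ^ n = 1" using \<beta> by auto
  then show "Pr0 ((G ^^ n) (proj ket1)) = 0" unfolding G' by (rule Pr0_funpow_rotation_period)
  have "z_coeff k \<beta> \<theta> = z_coeff k \<alpha> \<theta>" using \<beta> by (auto simp: z_coeff_def)
  then show "Pr0 ((G ^^ k) (proj ket0)) = complex_of_real (1 / 2 + 1 / 2 * z_coeff k \<alpha> \<theta>)"
    unfolding G' Pr0_funpow_rotation by simp
qed

theorem theorem1:
  fixes \<alpha> \<theta> :: real and G :: "complex mat \<Rightarrow> complex mat"
  assumes "(\<alpha>, \<theta>) \<in> ({0<..pi} \<times> {0<..pi / 2}) - {(pi, pi / 2)}"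
    and "\<alpha> / pi \<in> \<rat>"
    and "cpso G"
  shows "(Pr0 ((G ^^ n_alpha \<alpha>) (proj ket1)) = 0 \<and>
          (\<forall>k \<in> {1..n_alpha \<alpha>}.
             Pr0 ((G ^^ k) (proj ket0)) = complex_of_real (1 / 2 + 1 / 2 * z_coeff k \<alpha> \<theta>)))
         \<longleftrightarrow> G \<in> rotation_family \<alpha> \<theta>"
proof -
  have range: "0 < \<alpha>" "\<alpha> \<le> pi" "0 < \<theta>" "\<theta> \<le> pi / 2" "(\<alpha>, \<theta>) \<noteq> (pi, pi / 2)"
    using assms(1) by auto
  note n = n_alpha[OF range(1,2) assms(2)]
  show ?thesis
    using rotation_family_of_equations[OF range n assms(3)] equations_of_rotation_family[OF n(2)]
    by blast
qed

end
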